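(* Let $\|\cdot\|$ be an admissible norm on $\mathbb{R}^3$, and let $f:M\rightarrow(\mathbb{R}^3,\|\cdot\|)$ be an immersion of a compact, connected surface $M$ without boundary, endowed with a Birkhoff normal vector field $\eta:M\to\partial B$ and principal curvature functions $\lambda_1\geq\lambda_2$. Assume that $M$ has coercively convex curvature lines at any point where the greatest principal curvature function $\lambda_1$ attains a global maximum. If the Minkowski Gaussian curvature $K=\lambda_1\lambda_2$ of $M$ is constant, then $M$ (identified with $f(M)$) is a Minkowski sphere.
   Context: Let $B$ and $\partial B$ be the unit ball and unit sphere of $\|\cdot\|$. The norm is smooth if $\partial B$ is locally the graph of a $C^\infty$ function, and strictly convex if $\partial B$ contains no line segment. It is admissible if it is smooth, strictly convex, and $\partial B$ has positive Euclidean Gaussian curvature at every point. A Minkowski sphere of radius $\rho>0$ is a set $\{x:\|x-c\|=\rho\}$. A non-zero vector $v$ is Birkhoff orthogonal to a 2-dimensional subspace $H$ ($v\dashv_B H$) if the plane through $v/\|v\|$ parallel to $H$ supports $B$. For a smooth immersion $f:M\to\mathbb{R}^3$ of a surface, $M$ is identified with its image and $T_pM$ with the plane $df_p(T_pM)\subset\mathbb{R}^3$. A Birkhoff normal vector field (Birkhoff-Gauss map) is a smooth map $\eta$ into $\partial B$ with $\eta(p)\dashv_B T_pM$; it is unique up to sign, exists locally, and exists globally iff $M$ is orientable. Since $T_{\eta(p)}\partial B$ and $T_pM$ are the same plane, $d\eta_p$ is a linear endomorphism of $T_pM$; it is diagonalizable over $\mathbb{R}$. Its eigenvalues $\lambda_1(p)\ge\lambda_2(p)$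 are the principal curvatures, its eigenvectors the principal directions. A point is umbilic if $\lambda_1(p)=\lambda_2(p)$. Coercive convexity: let $D$ be the standard flat connection of $\mathbb{R}^3$. Near a non-umbilic point $p$ choose non-vanishing vector fields $V_1,V_2$ on $M$ that are principal directions for $\lambda_1,\lambda_2$ respectively, scaled so that $[V_1,V_2]=0$. Then $D_{V_1}V_2$ is tangent to $M$, and one writes $D_{V_1}V_2=f_1V_1+g_1V_2$ with smooth functions $f_1,g_1$. $M$ has coercively convex curvature lines at $p$ if the following holds: whenever $D_{V_1}V_2|_p=0$, the component $f_1$ of $D_{V_1}V_2$ along $V_1$, restricted to the trajectory $\gamma$ of $V_2$ through $p$, has negative derivative at $p$, i.e. $V_2(f_1)(p)<0$. At umbilic points the condition is regarded as vacuous. *)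

theory Defs
  imports "HOL-Analysis.Analysis"
begin

section \<open>Smooth maps on open subsets of normed spaces\<close>

text \<open>Only used for open sets \<open>S\<close> in a finite-dimensional space, where continuity of all iterated
  directional derivatives is the usual notion of being of class \<open>C\<^sup>k\<close>.\<close>

primrec ck_on :: "nat \<Rightarrow> 'a::real_normed_vector set \<Rightarrow> ('a \<Rightarrow> 'b::real_normed_vector) \<Rightarrow> bool" where
  "ck_on 0 S f \<longleftrightarrow> continuous_on S f"
| "ck_on (Suc k) S f \<longleftrightarrow> (\<forall>x\<in>S. f differentiable (at x)) \<and>
     (\<forall>v. ck_on k S (\<lambda>x. frechet_derivative f (at x) v))"

definition smooth_on :: "'a::real_normed_vector set \<Rightarrow> ('a \<Rightarrow> 'b::real_normed_vector) \<Rightarrow> bool" where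
  "smooth_on S f \<longleftrightarrow> (\<forall>k. ck_on k S f)"

definition partial :: "2 \<Rightarrow> (real^2 \<Rightarrow> 'b::real_normed_vector) \<Rightarrow> real^2 \<Rightarrow> 'b" where
  "partial i r u = frechet_derivative r (at u) (axis i 1)"


section \<open>Surfaces in Euclidean space and admissible norms\<close>

text \<open>\<open>L\<close> is a choice of Cartesian coordinates: a linear isometry of \<open>\<real>\<^sup>2 \<times> \<real>\<close> onto \<open>\<real>\<^sup>3\<close>
  (surjective by dimension).\<close>

definition locally_smooth_graph :: "(real^3) set \<Rightarrow> bool" where
  "locally_smooth_graph S \<longleftrightarrow>
     (\<forall>p\<in>S. \<exists>W (L :: (real^2) \<times> real \<Rightarrow> real^3) U (h :: real^2 \<Rightarrow> real).
        open W \<and> p \<in> W \<and> linear L \<and> (\<forall>z. norm (L z) = norm z) \<and>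
        open U \<and> smooth_on U h \<and> S \<inter> W = (\<lambda>u. L (u, h u)) ` U)"

definition regular_patch :: "(real^3) set \<Rightarrow> (real^2) set \<Rightarrow> (real^2 \<Rightarrow> real^3) \<Rightarrow> bool" where
  "regular_patch S U r \<longleftrightarrow> open U \<and> smooth_on U r \<and> inj_on r U \<and> r ` U \<subseteq> S \<and>
     (\<forall>u\<in>U. cross3 (partial 1 r u) (partial 2 r u) \<noteq> 0)"

definition unit_normal :: "(real^2 \<Rightarrow> real^3) \<Rightarrow> real^2 \<Rightarrow> real^3" where
  "unit_normal r u = sgn (cross3 (partial 1 r u) (partial 2 r u))"

definition first_form :: "(real^2 \<Rightarrow> real^3) \<Rightarrow> real^2 \<Rightarrow> 2 \<Rightarrow> 2 \<Rightarrow> real" where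
  "first_form r u i j = partial i r u \<bullet> partial j r u"

definition second_form :: "(real^2 \<Rightarrow> real^3) \<Rightarrow> real^2 \<Rightarrow> 2 \<Rightarrow> 2 \<Rightarrow> real" where
  "second_form r u i j = partial i (partial j r) u \<bullet> unit_normal r u"

definition euclidean_gauss_curvature :: "(real^2 \<Rightarrow> real^3) \<Rightarrow> real^2 \<Rightarrow> real" where
  "euclidean_gauss_curvature r u =
     (second_form r u 1 1 * second_form r u 2 2 - (second_form r u 1 2)\<^sup>2) /
     (first_form r u 1 1 * first_form r u 2 2 - (first_form r u 1 2)\<^sup>2)"

text \<open>The curvature at a point of \<open>S\<close> is the same for all regular patches through that point.\<close>

definition positive_gauss_curvature :: "(real^3) set \<Rightarrow> bool" where
  "positive_gauss_curvature S \<longleftrightarrow>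
     (\<forall>U r. regular_patch S U r \<longrightarrow> (\<forall>u\<in>U. 0 < euclidean_gauss_curvature r u))"

definition is_norm :: "(real^3 \<Rightarrow> real) \<Rightarrow> bool" where
  "is_norm nrm \<longleftrightarrow> (\<forall>x. 0 \<le> nrm x) \<and> (\<forall>x. nrm x = 0 \<longleftrightarrow> x = 0) \<and>
     (\<forall>a x. nrm (a *\<^sub>R x) = \<bar>a\<bar> * nrm x) \<and> (\<forall>x y. nrm (x + y) \<le> nrm x + nrm y)"

definition unit_ball :: "(real^3 \<Rightarrow> real) \<Rightarrow> (real^3) set" where
  "unit_ball nrm = {x. nrm x \<le> 1}"

definition unit_sphere :: "(real^3 \<Rightarrow> real) \<Rightarrow> (real^3) set" where
  "unit_sphere nrm = {x. nrm x = 1}"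

definition admissible_norm :: "(real^3 \<Rightarrow> real) \<Rightarrow> bool" where
  "admissible_norm nrm \<longleftrightarrow> is_norm nrm \<and>
     locally_smooth_graph (unit_sphere nrm) \<and>
     (\<forall>x y. x \<noteq> y \<longrightarrow> \<not> closed_segment x y \<subseteq> unit_sphere nrm) \<and>
     positive_gauss_curvature (unit_sphere nrm)"

definition minkowski_sphere :: "(real^3 \<Rightarrow> real) \<Rightarrow> (real^3) set \<Rightarrow> bool" where
  "minkowski_sphere nrm S \<longleftrightarrow> (\<exists>c \<rho>. \<rho> > 0 \<and> S = {x. nrm (x - c) = \<rho>})"

definition supporting_plane :: "(real^3) set \<Rightarrow> (real^3) set \<Rightarrow> bool" where
  "supporting_plane P B \<longleftrightarrow>
     (\<exists>n b. n \<noteq> 0 \<and> P = {x. n \<bullet> x = b} \<and> P \<inter> B \<noteq> {} \<and> (\<forall>x\<in>B. n \<bullet> x \<le> b))"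

definition birkhoff_orthogonal :: "(real^3 \<Rightarrow> real) \<Rightarrow> real^3 \<Rightarrow> (real^3) set \<Rightarrow> bool" where
  "birkhoff_orthogonal nrm v H \<longleftrightarrow> v \<noteq> 0 \<and> subspace H \<and> dim H = 2 \<and>
     supporting_plane ((\<lambda>h. v /\<^sub>R nrm v + h) ` H) (unit_ball nrm)"


section \<open>Abstract smooth surfaces\<close>

text \<open>A chart is a pair of its domain and its coordinate map. The values of the coordinate map
  outside the domain are irrelevant.\<close>

type_synonym 'm chart = "'m set \<times> ('m \<Rightarrow> real^2)"

definition coord_rep :: "'m chart \<Rightarrow> ('m \<Rightarrow> 'b) \<Rightarrow> real^2 \<Rightarrow> 'b" where
  "coord_rep c g = g \<circ> inv_into (fst c) (snd c)"

definition smooth_surface :: "'m::t2_space set \<Rightarrow> 'm chart set \<Rightarrow> bool" where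
  "smooth_surface M A \<longleftrightarrow> (\<Union>c\<in>A. fst c) = M \<and>
     (\<forall>c\<in>A. openin (top_of_set M) (fst c) \<and> open (snd c ` fst c) \<and>
        homeomorphism (fst c) (snd c ` fst c) (snd c) (inv_into (fst c) (snd c))) \<and>
     (\<forall>c\<in>A. \<forall>d\<in>A. smooth_on (snd c ` (fst c \<inter> fst d)) (coord_rep c (snd d)))"

text \<open>\<open>W\<close> is meant to be a relatively open subset of the surface.\<close>

definition smooth_map_on :: "'m chart set \<Rightarrow> 'm set \<Rightarrow> ('m \<Rightarrow> 'b::real_normed_vector) \<Rightarrow> bool" where
  "smooth_map_on A W g \<longleftrightarrow> (\<forall>c\<in>A. smooth_on (snd c ` (fst c \<inter> W)) (coord_rep c g))"

definition coord_differential ::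
    "'m chart \<Rightarrow> ('m \<Rightarrow> 'b::real_normed_vector) \<Rightarrow> 'm \<Rightarrow> real^2 \<Rightarrow> 'b" where
  "coord_differential c g p = frechet_derivative (coord_rep c g) (at (snd c p))"

definition chart_at :: "'m chart set \<Rightarrow> 'm \<Rightarrow> 'm chart" where
  "chart_at A p = (SOME c. c \<in> A \<and> p \<in> fst c)"

definition immersion :: "'m::t2_space set \<Rightarrow> 'm chart set \<Rightarrow> ('m \<Rightarrow> real^3) \<Rightarrow> bool" where
  "immersion M A f \<longleftrightarrow> smooth_map_on A M f \<and>
     (\<forall>c\<in>A. \<forall>p\<in>fst c. inj (coord_differential c f p))"

text \<open>Tangent vectors of \<open>M\<close> at \<open>p\<close> are identified with vectors of the plane
  \<open>df\<^sub>p(T\<^sub>pM)\<close> in \<open>\<real>\<^sup>3\<close>. By the chain rule, neither this plane nor the derivative of a map \<open>g\<close> on \<open>M\<close>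
  along such a vector depends on the chart selected by \<open>chart_at\<close>.\<close>

definition tangent_plane :: "'m chart set \<Rightarrow> ('m \<Rightarrow> real^3) \<Rightarrow> 'm \<Rightarrow> (real^3) set" where
  "tangent_plane A f p = range (coord_differential (chart_at A p) f p)"

definition deriv_along :: "'m chart set \<Rightarrow> ('m \<Rightarrow> real^3) \<Rightarrow> ('m \<Rightarrow> 'b::real_normed_vector) \<Rightarrow>
    'm \<Rightarrow> real^3 \<Rightarrow> 'b" where
  "deriv_along A f g p v =
     coord_differential (chart_at A p) g p (THE a. coord_differential (chart_at A p) f p a = v)"

definition tangent_field_on ::
    "'m chart set \<Rightarrow> ('m \<Rightarrow> real^3) \<Rightarrow> 'm set \<Rightarrow> ('m \<Rightarrow> real^3) \<Rightarrow> bool" where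
  "tangent_field_on A f W V \<longleftrightarrow> smooth_map_on A W V \<and> (\<forall>q\<in>W. V q \<in> tangent_plane A f q)"

text \<open>\<open>[V, V'] = 0\<close>, with vector fields acting as derivations on smooth functions.\<close>

definition bracket_zero_on :: "'m chart set \<Rightarrow> ('m \<Rightarrow> real^3) \<Rightarrow> 'm set \<Rightarrow>
    ('m \<Rightarrow> real^3) \<Rightarrow> ('m \<Rightarrow> real^3) \<Rightarrow> bool" where
  "bracket_zero_on A f W V V' \<longleftrightarrow>
     (\<forall>g :: 'm \<Rightarrow> real. smooth_map_on A W g \<longrightarrow> (\<forall>q\<in>W.
        deriv_along A f (\<lambda>r. deriv_along A f g r (V' r)) q (V q) -
        deriv_along A f (\<lambda>r. deriv_along A f g r (V r)) q (V' q) = 0))"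


section \<open>Birkhoff normal fields and principal curvatures\<close>

definition birkhoff_normal_field :: "(real^3 \<Rightarrow> real) \<Rightarrow> 'm::t2_space set \<Rightarrow> 'm chart set \<Rightarrow>
    ('m \<Rightarrow> real^3) \<Rightarrow> ('m \<Rightarrow> real^3) \<Rightarrow> bool" where
  "birkhoff_normal_field nrm M A f \<eta> \<longleftrightarrow> smooth_map_on A M \<eta> \<and>
     (\<forall>p\<in>M. \<eta> p \<in> unit_sphere nrm \<and> birkhoff_orthogonal nrm (\<eta> p) (tangent_plane A f p))"

text \<open>\<open>d\<eta>\<^sub>p v = \<mu> v\<close> with \<open>v\<close> a non-zero tangent vector.\<close>

definition principal_direction :: "'m chart set \<Rightarrow> ('m \<Rightarrow> real^3) \<Rightarrow> ('m \<Rightarrow> real^3) \<Rightarrow> 'm \<Rightarrow>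
    real \<Rightarrow> real^3 \<Rightarrow> bool" where
  "principal_direction A f \<eta> p \<mu> v \<longleftrightarrow>
     v \<in> tangent_plane A f p \<and> v \<noteq> 0 \<and> deriv_along A f \<eta> p v = \<mu> *\<^sub>R v"

definition principal_curvatures ::
    "'m chart set \<Rightarrow> ('m \<Rightarrow> real^3) \<Rightarrow> ('m \<Rightarrow> real^3) \<Rightarrow> 'm \<Rightarrow> real set" where
  "principal_curvatures A f \<eta> p = {\<mu>. \<exists>v. principal_direction A f \<eta> p \<mu> v}"

text \<open>As \<open>d\<eta>\<^sub>p\<close> is diagonalizable on a plane, the set above has one or two elements; if it has one,
  that eigenvalue is double.\<close>

definition curv1 :: "'m chart set \<Rightarrow> ('m \<Rightarrow> real^3) \<Rightarrow> ('m \<Rightarrow> real^3) \<Rightarrow> 'm \<Rightarrow> real" where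
  "curv1 A f \<eta> p = Max (principal_curvatures A f \<eta> p)"

definition curv2 :: "'m chart set \<Rightarrow> ('m \<Rightarrow> real^3) \<Rightarrow> ('m \<Rightarrow> real^3) \<Rightarrow> 'm \<Rightarrow> real" where
  "curv2 A f \<eta> p = Min (principal_curvatures A f \<eta> p)"

definition minkowski_gauss_curvature ::
    "'m chart set \<Rightarrow> ('m \<Rightarrow> real^3) \<Rightarrow> ('m \<Rightarrow> real^3) \<Rightarrow> 'm \<Rightarrow> real" where
  "minkowski_gauss_curvature A f \<eta> p = curv1 A f \<eta> p * curv2 A f \<eta> p"

definition umbilic :: "'m chart set \<Rightarrow> ('m \<Rightarrow> real^3) \<Rightarrow> ('m \<Rightarrow> real^3) \<Rightarrow> 'm \<Rightarrow> bool" where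
  "umbilic A f \<eta> p \<longleftrightarrow> curv1 A f \<eta> p = curv2 A f \<eta> p"


section \<open>Coercively convex curvature lines\<close>

definition commuting_principal_frame :: "'m::t2_space set \<Rightarrow> 'm chart set \<Rightarrow> ('m \<Rightarrow> real^3) \<Rightarrow>
    ('m \<Rightarrow> real^3) \<Rightarrow> 'm set \<Rightarrow> ('m \<Rightarrow> real^3) \<Rightarrow> ('m \<Rightarrow> real^3) \<Rightarrow> bool" where
  "commuting_principal_frame M A f \<eta> W V\<^sub>1 V\<^sub>2 \<longleftrightarrow>
     openin (top_of_set M) W \<and> (\<forall>q\<in>W. \<not> umbilic A f \<eta> q) \<and>
     tangent_field_on A f W V\<^sub>1 \<and> tangent_field_on A f W V\<^sub>2 \<and>
     (\<forall>q\<in>W. principal_direction A f \<eta> q (curv1 A f \<eta> q) (V\<^sub>1 q) \<and>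
            principal_direction A f \<eta> q (curv2 A f \<eta> q) (V\<^sub>2 q)) \<and>
     bracket_zero_on A f W V\<^sub>1 V\<^sub>2"

text \<open>The coefficient \<open>a\<close> in \<open>w = a v\<^sub>1 + b v\<^sub>2\<close>, for linearly independent \<open>v\<^sub>1\<close>, \<open>v\<^sub>2\<close>.\<close>

definition first_coefficient :: "real^3 \<Rightarrow> real^3 \<Rightarrow> real^3 \<Rightarrow> real" where
  "first_coefficient v\<^sub>1 v\<^sub>2 w = (THE a. \<exists>b. w = a *\<^sub>R v\<^sub>1 + b *\<^sub>R v\<^sub>2)"

text \<open>\<open>deriv_along A f V\<^sub>2 q (V\<^sub>1 q)\<close> is \<open>D\<^bsub>V\<^sub>1\<^esub>V\<^sub>2\<close> at \<open>q\<close> for the flat connection \<open>D\<close>. A commuting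
  principal frame exists near every non-umbilic point, and the condition does not depend on which
  one is chosen: another one is \<open>a V\<^sub>1\<close>, \<open>b V\<^sub>2\<close> with \<open>V\<^sub>2(a) = V\<^sub>1(b) = 0\<close>, which replaces \<open>f\<^sub>1\<close> by \<open>b f\<^sub>1\<close>,
  and \<open>V\<^sub>2(f\<^sub>1)(p)\<close> by \<open>b(p)\<^sup>2 V\<^sub>2(f\<^sub>1)(p)\<close> when \<open>f\<^sub>1(p) = 0\<close>.\<close>

definition coercively_convex_at :: "'m::t2_space set \<Rightarrow> 'm chart set \<Rightarrow> ('m \<Rightarrow> real^3) \<Rightarrow>
    ('m \<Rightarrow> real^3) \<Rightarrow> 'm \<Rightarrow> bool" where
  "coercively_convex_at M A f \<eta> p \<longleftrightarrow> (\<not> umbilic A f \<eta> p \<longrightarrow>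
     (\<exists>W V\<^sub>1 V\<^sub>2. p \<in> W \<and> commuting_principal_frame M A f \<eta> W V\<^sub>1 V\<^sub>2 \<and>
        (deriv_along A f V\<^sub>2 p (V\<^sub>1 p) = 0 \<longrightarrow>
         deriv_along A f
           (\<lambda>q. first_coefficient (V\<^sub>1 q) (V\<^sub>2 q) (deriv_along A f V\<^sub>2 q (V\<^sub>1 q))) p (V\<^sub>2 p) < 0)))"

end

theory Submission
  imports Defs
begin

text \<open>
  Write \<open>F\<close> and \<open>E\<close> for \<open>f\<close> and \<open>\<eta>\<close> read in a chart. Near \<open>E u\<close> the unit sphere is the image of a graph
  parametrization \<open>r\<close>, so that \<open>E = r \<circ> Y\<close>, and the normal \<open>r\<^sub>1 \<times> r\<^sub>2\<close> at \<open>Y u\<close> is also normal to the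
  surface at \<open>F u\<close>. Differentiating this orthogonality shows that \<open>d\<eta>\<close> is self-adjoint for the second
  fundamental form of the unit sphere, which is definite because the sphere has positive Gaussian
  curvature (\<open>birkhoff_shape_operator_selfadjoint\<close>). Hence \<open>d\<eta>\<close> is diagonalizable, it is scalar where its
  eigenvalues coincide, and its eigenvalues are the roots of a quadratic polynomial with smooth
  coefficients: \<open>curv1\<close> is continuous everywhere and both curvatures are smooth off the umbilics.

  At a point of \<open>M\<close> farthest from the origin the second fundamental form of \<open>M\<close> is definite, so
  the constant \<open>K = \<lambda>\<^sub>1 \<lambda>\<^sub>2\<close> is positive (\<open>gauss_curvature_positive_somewhere\<close>). Let \<open>p\<close> be a point where
  \<open>\<lambda>\<^sub>1\<close> is maximal, and suppose that \<open>p\<close> is not umbilic. For a commuting principal frame put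
  \<open>X = D\<^bsub>V\<^sub>1\<^esub>V\<^sub>2 = D\<^bsub>V\<^sub>2\<^esub>V\<^sub>1\<close>. As \<open>d\<eta>(V\<^sub>i) = \<lambda>\<^sub>i V\<^sub>i\<close> and second derivatives of \<open>\<eta>\<close> along commuting fields agree,
  \<open>D\<^bsub>V\<^sub>1\<^esub>(\<lambda>\<^sub>2 V\<^sub>2) = D\<^bsub>V\<^sub>2\<^esub>(\<lambda>\<^sub>1 V\<^sub>1)\<close>, which is the Codazzi equation
  \<open>(\<lambda>\<^sub>2 - \<lambda>\<^sub>1) X = V\<^sub>2(\<lambda>\<^sub>1) V\<^sub>1 - V\<^sub>1(\<lambda>\<^sub>2) V\<^sub>2\<close>. At \<open>p\<close> both \<open>\<lambda>\<^sub>1\<close> and \<open>\<lambda>\<^sub>2 = K / \<lambda>\<^sub>1\<close> are critical, so \<open>X = 0\<close> there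
  and coercive convexity applies: \<open>f\<^sub>1 = V\<^sub>2(\<lambda>\<^sub>1) / (\<lambda>\<^sub>2 - \<lambda>\<^sub>1)\<close> has negative derivative along \<open>V\<^sub>2\<close>. Since
  \<open>\<lambda>\<^sub>2 < \<lambda>\<^sub>1\<close>, this says that \<open>V\<^sub>2(V\<^sub>2(\<lambda>\<^sub>1)) > 0\<close> at \<open>p\<close>, against the maximality of \<open>\<lambda>\<^sub>1\<close>
  (\<open>coercive_maximum_imp_umbilic\<close>).

  So \<open>p\<close> is umbilic. With \<open>K\<close> constant and positive, \<open>\<lambda>\<^sub>1\<close> cannot drop below its maximum without \<open>\<lambda>\<^sub>2\<close>
  exceeding \<open>\<lambda>\<^sub>1\<close>, so \<open>\<lambda>\<^sub>1 = \<lambda>\<^sub>2\<close> is a constant \<open>\<lambda>\<close> on all of \<open>M\<close>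
  (\<open>umbilic_maximum_imp_totally_umbilic\<close>). Then \<open>\<eta> - \<lambda> f\<close> is constant, so \<open>f\<close> maps \<open>M\<close> into a Minkowski
  sphere, and onto it because every support direction of the unit ball is attained by \<open>\<eta>\<close>
  (\<open>totally_umbilic_imp_minkowski_sphere\<close>).
\<close>

section \<open>Calculus of \<open>C\<^sup>k\<close> maps\<close>

abbreviation fd :: "('a::real_normed_vector \<Rightarrow> 'b::real_normed_vector) \<Rightarrow> 'a \<Rightarrow> 'a \<Rightarrow> 'b" where
  "fd f x \<equiv> frechet_derivative f (at x)"

lemma fd_eqI: "(f has_derivative f') (at x) \<Longrightarrow> fd f x = f'"
  using frechet_derivative_at by metis

lemma fd_apply_eqI: "(f has_derivative f') (at x) \<Longrightarrow> fd f x v = f' v"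
  by (simp add: fd_eqI)

lemma fd_works: "f differentiable (at x) \<Longrightarrow> (f has_derivative fd f x) (at x)"
  using frechet_derivative_works by blast

lemma fd_linear: "f differentiable (at x) \<Longrightarrow> linear (fd f x)"
  by (rule linear_frechet_derivative)

lemma fd_cong:
  assumes "open S" "x \<in> S" "\<And>y. y \<in> S \<Longrightarrow> f y = g y"
  shows "fd f x = fd g x"
proof -
  have "(f has_derivative d) (at x) \<longleftrightarrow> (g has_derivative d) (at x)" for d
    using has_derivative_transform_within_open[OF _ assms(1,2)] assms(3) by metis
  then show ?thesis unfolding frechet_derivative_def by simp
qed

lemma differentiable_cong_open:
  assumes "open S" "x \<in> S" "\<And>y. y \<in> S \<Longrightarrow> f y = g y" "f differentiable (at x)"
  shows "g differentiable (at x)"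
  using has_derivative_transform_within_open[OF fd_works[OF assms(4)] assms(1,2)] assms(3)
    differentiableI by metis

lemma ck_on_pred: "ck_on (Suc k) S f \<Longrightarrow> ck_on k S f"
proof (induction k arbitrary: f)
  case 0
  then show ?case
    by (auto intro!: continuous_at_imp_continuous_on differentiable_imp_continuous_within)
next
  case (Suc k)
  then show ?case by (metis ck_on.simps(2))
qed

lemma ck_on_subset: "ck_on k S f \<Longrightarrow> T \<subseteq> S \<Longrightarrow> ck_on k T f"
  by (induction k arbitrary: f) (auto intro: continuous_on_subset)

lemma ck_on_cong:
  assumes "open S" "\<And>x. x \<in> S \<Longrightarrow> f x = g x" "ck_on k S f"
  shows "ck_on k S g"
  using assms(2,3)
proof (induction k arbitrary: f g)
  case 0
  then show ?case using continuous_on_cong by (metis ck_on.simps(1))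
next
  case (Suc k)
  have "g differentiable (at x)" if "x \<in> S" for x
    using differentiable_cong_open[OF \<open>open S\<close> that Suc.prems(1)] Suc.prems(2) that by auto
  moreover have "ck_on k S (\<lambda>x. fd g x v)" for v
    using Suc.IH[of "\<lambda>x. fd f x v" "\<lambda>x. fd g x v"] Suc.prems fd_cong[OF \<open>open S\<close> _ Suc.prems(1)]
    by auto
  ultimately show ?case by simp
qed

text \<open>Any formula for the derivative may be used to check smoothness: it agrees with the derivative on an
  open set, and \<open>C\<^sup>k\<close> regularity there depends on nothing else.\<close>

lemma ck_on_SucI:
  assumes "open S" "\<And>x. x \<in> S \<Longrightarrow> (f has_derivative f' x) (at x)" "\<And>v. ck_on k S (\<lambda>x. f' x v)"
  shows "ck_on (Suc k) S f"
proof -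
  have "ck_on k S (\<lambda>x. fd f x v)" for v
    by (rule ck_on_cong[OF assms(1) _ assms(3)]) (simp add: fd_eqI[OF assms(2)])
  then show ?thesis using assms(2) by (auto intro: differentiableI)
qed

lemma ck_on_const: "ck_on k S (\<lambda>x. c)"
  by (induction k arbitrary: c) (auto simp: frechet_derivative_const)

lemma ck_on_add:
  assumes "open S" "ck_on k S f" "ck_on k S g"
  shows "ck_on k S (\<lambda>x. f x + g x)"
  using assms(2,3)
proof (induction k arbitrary: f g)
  case 0
  then show ?case by (auto intro: continuous_on_add)
next
  case (Suc k)
  show ?case
    by (rule ck_on_SucI[OF assms(1), where f' = "\<lambda>x v. fd f x v + fd g x v"])
      (use Suc in \<open>auto intro!: has_derivative_add fd_works\<close>)
qed

lemma ck_on_linear: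
  assumes "open S" "bounded_linear L" "ck_on k S f"
  shows "ck_on k S (\<lambda>x. L (f x))"
  using assms(3)
proof (induction k arbitrary: f)
  case 0
  then show ?case using bounded_linear.continuous_on[OF assms(2)] by auto
next
  case (Suc k)
  show ?case
    by (rule ck_on_SucI[OF assms(1), where f' = "\<lambda>x v. L (fd f x v)"])
      (use Suc in \<open>auto intro!: bounded_linear.has_derivative[OF assms(2)] fd_works\<close>)
qed

lemma ck_on_bilinear:
  assumes "open S" "bounded_bilinear pr" "ck_on k S f" "ck_on k S g"
  shows "ck_on k S (\<lambda>x. pr (f x) (g x))"
  using assms(3,4)
proof (induction k arbitrary: f g)
  case 0
  then show ?case using bounded_bilinear.continuous_on[OF assms(2)] by auto
next
  case (Suc k)
  have f: "ck_on k S f" and g: "ck_on k S g" using Suc.prems ck_on_pred by auto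
  show ?case
  proof (rule ck_on_SucI[OF assms(1), where f' = "\<lambda>x v. pr (f x) (fd g x v) + pr (fd f x v) (g x)"])
    show "((\<lambda>x. pr (f x) (g x)) has_derivative (\<lambda>v. pr (f x) (fd g x v) + pr (fd f x v) (g x))) (at x)"
      if "x \<in> S" for x
      using Suc.prems that by (auto intro!: bounded_bilinear.FDERIV[OF assms(2)] fd_works)
    show "ck_on k S (\<lambda>x. pr (f x) (fd g x v) + pr (fd f x v) (g x))" for v
      using Suc f g by (auto intro!: ck_on_add assms(1))
  qed
qed

lemma ck_on_ident: "open S \<Longrightarrow> ck_on k S (\<lambda>x. x)"
proof (cases k)
  case (Suc n)
  assume "open S"
  then show ?thesis
    unfolding Suc by (rule ck_on_SucI[where f' = "\<lambda>x v. v"]) (auto intro: ck_on_const)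
qed auto

lemmas ck_on_mult = ck_on_bilinear[OF _ bounded_bilinear_mult]
lemmas ck_on_scaleR = ck_on_bilinear[OF _ bounded_bilinear_scaleR]
lemmas ck_on_inner = ck_on_bilinear[OF _ bounded_bilinear_inner]

lemma bounded_bilinear_cross3: "bounded_bilinear cross3"
  using bilinear_cross by (simp add: bilinear_conv_bounded_bilinear)

lemmas ck_on_cross3 = ck_on_bilinear[OF _ bounded_bilinear_cross3]

lemma ck_on_cmult: "open S \<Longrightarrow> ck_on k S f \<Longrightarrow> ck_on k S (\<lambda>x. c * f x)" for f :: "_ \<Rightarrow> real"
  by (rule ck_on_linear[OF _ bounded_linear_mult_right])

lemma ck_on_minus: "open S \<Longrightarrow> ck_on k S f \<Longrightarrow> ck_on k S (\<lambda>x. - f x)"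
  by (rule ck_on_linear[OF _ bounded_linear_minus[OF bounded_linear_ident]])

lemma ck_on_diff: "open S \<Longrightarrow> ck_on k S f \<Longrightarrow> ck_on k S g \<Longrightarrow> ck_on k S (\<lambda>x. f x - g x)"
  using ck_on_add[OF _ _ ck_on_minus, of S k f g] by simp

lemma ck_on_inverse:
  fixes f :: "'a::real_normed_vector \<Rightarrow> real"
  assumes "open S" "ck_on k S f" "\<And>x. x \<in> S \<Longrightarrow> f x \<noteq> 0"
  shows "ck_on k S (\<lambda>x. inverse (f x))"
  using assms(2)
proof (induction k)
  case 0
  then show ?case using assms(3) by (auto intro: continuous_on_inverse)
next
  case (Suc k)
  show ?case
  proof (rule ck_on_SucI[OF assms(1), where f' = "\<lambda>x v. - (inverse (f x) * fd f x v * inverse (f x))"])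
    show "((\<lambda>x. inverse (f x)) has_derivative (\<lambda>v. - (inverse (f x) * fd f x v * inverse (f x)))) (at x)"
      if "x \<in> S" for x
      using Suc.prems that assms(3) by (auto intro!: Deriv.has_derivative_inverse fd_works)
    show "ck_on k S (\<lambda>x. - (inverse (f x) * fd f x v * inverse (f x)))" for v
      using Suc ck_on_pred[OF Suc.prems] by (auto intro!: ck_on_minus ck_on_mult assms(1))
  qed
qed

lemma ck_on_divide:
  fixes f g :: "'a::real_normed_vector \<Rightarrow> real"
  assumes "open S" "ck_on k S f" "ck_on k S g" "\<And>x. x \<in> S \<Longrightarrow> g x \<noteq> 0"
  shows "ck_on k S (\<lambda>x. f x / g x)"
  unfolding divide_inverse by (intro ck_on_mult ck_on_inverse assms)

lemma ck_on_sqrt: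
  fixes f :: "'a::real_normed_vector \<Rightarrow> real"
  assumes "open S" "ck_on k S f" "\<And>x. x \<in> S \<Longrightarrow> f x > 0"
  shows "ck_on k S (\<lambda>x. sqrt (f x))"
  using assms(2)
proof (induction k)
  case 0
  then show ?case by (auto intro: continuous_intros)
next
  case (Suc k)
  show ?case
  proof (rule ck_on_SucI[OF assms(1), where f' = "\<lambda>x v. (1/2) * (inverse (sqrt (f x)) * fd f x v)"])
    show "((\<lambda>x. sqrt (f x)) has_derivative (\<lambda>v. (1/2) * (inverse (sqrt (f x)) * fd f x v))) (at x)"
      if "x \<in> S" for x
      using has_derivative_real_sqrt[OF assms(3)[OF that] fd_works[of f x]] Suc.prems that
      by (auto simp: field_simps)
    show "ck_on k S (\<lambda>x. (1/2) * (inverse (sqrt (f x)) * fd f x v))" for v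
      using Suc ck_on_pred[OF Suc.prems] assms(3)
      by (intro ck_on_cmult ck_on_mult ck_on_inverse assms(1)) (auto simp: order_less_le)
  qed
qed

lemma smooth_onD: "smooth_on S f \<Longrightarrow> ck_on k S f"
  by (simp add: smooth_on_def)

lemma smooth_on_differentiable: "smooth_on S f \<Longrightarrow> x \<in> S \<Longrightarrow> f differentiable (at x)"
  using smooth_onD[of S f "Suc 0"] by auto

lemma smooth_on_fd: "smooth_on S f \<Longrightarrow> smooth_on S (\<lambda>x. fd f x v)"
  unfolding smooth_on_def by (metis ck_on.simps(2))

lemma smooth_on_continuous: "smooth_on S f \<Longrightarrow> continuous_on S f"
  using smooth_onD[of S f 0] by auto

section \<open>Second derivatives\<close>

text \<open>By the mean value theorem for \<open>s \<mapsto> g (x + s v + t w) - g (x + s v)\<close>, the second difference equals \<open>t\<close>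
  times a difference of the derivative of \<open>g\<close> along \<open>v\<close>; differentiability of that function at \<open>x\<close>
  alone gives the limit. The quotient is symmetric in \<open>v\<close> and \<open>w\<close>, which yields Schwarz's theorem.\<close>

lemma second_difference_quotient_real:
  fixes g :: "'a::real_normed_vector \<Rightarrow> real"
  assumes "open S" "x \<in> S" "\<And>y. y \<in> S \<Longrightarrow> g differentiable (at y)"
    and "(\<lambda>y. fd g y v) differentiable (at x)"
  shows "((\<lambda>t. (g (x + t *\<^sub>R v + t *\<^sub>R w) - g (x + t *\<^sub>R v) - g (x + t *\<^sub>R w) + g x) / t\<^sup>2)
            \<longlongrightarrow> fd (\<lambda>y. fd g y v) x w) (at_right 0)"
proof (rule tendstoI)
  fix e :: real assume "e > 0"
  define \<phi> where "\<phi> y = fd g y v" for y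
  define d where "d = fd \<phi> x"
  have der: "(\<phi> has_derivative d) (at x)"
    using assms(4) unfolding d_def \<phi>_def by (rule fd_works)
  have lin: "linear d" using der has_derivative_linear by blast
  \<comment> \<open>Steps shorter than \<open>min r s / C\<close> keep all corners of the parallelogram in the ball of radius \<open>min r s\<close>,
      and \<open>norm v + norm w < C\<close> makes the final estimate strict.\<close>
  define C where "C = 2 * norm v + norm w + 1"
  have C: "C > 0" unfolding C_def by (smt (verit) norm_ge_zero)
  obtain r where r: "r > 0" "ball x r \<subseteq> S" using assms(1,2) openE by blast
  obtain s where s: "s > 0" "\<And>y. norm (y - x) < s \<Longrightarrow> \<bar>\<phi> y - \<phi> x - d (y - x)\<bar> \<le> e / (2 * C) * norm (y - x)"
    using has_derivative_at_alt[of \<phi> d x] der \<open>e > 0\<close> C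
    by (metis divide_pos_pos mult_pos_pos real_norm_def zero_less_numeral)
  define m where "m = min r s / C"
  have m: "m > 0" using r s C by (simp add: m_def)
  have "\<bar>(g (x + t *\<^sub>R v + t *\<^sub>R w) - g (x + t *\<^sub>R v) - g (x + t *\<^sub>R w) + g x) / t\<^sup>2 - d w\<bar> < e"
    if t: "0 < t" "t < m" for t
  proof -
    have small: "norm (a *\<^sub>R v + b *\<^sub>R w) < min r s \<and> norm (a *\<^sub>R v + b *\<^sub>R w) \<le> t * (norm v + norm w)"
      if "0 \<le> a" "a \<le> t" "0 \<le> b" "b \<le> t" for a b
    proof -
      have "norm (a *\<^sub>R v + b *\<^sub>R w) \<le> a * norm v + b * norm w"
        using that by (metis abs_of_nonneg norm_scaleR norm_triangle_ineq)
      also have "\<dots> \<le> t * norm v + t * norm w"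
        using that by (intro add_mono mult_right_mono) auto
      finally have 1: "norm (a *\<^sub>R v + b *\<^sub>R w) \<le> t * (norm v + norm w)" by (simp add: algebra_simps)
      have "t * (norm v + norm w) \<le> t * C" using t C_def
        by (intro mult_left_mono) auto
      also have "\<dots> < m * C" using t C by simp
      also have "\<dots> = min r s" using C by (simp add: m_def)
      finally show ?thesis using 1 by simp
    qed
    have inS: "x + (a *\<^sub>R v + b *\<^sub>R w) \<in> S" if "0 \<le> a" "a \<le> t" "0 \<le> b" "b \<le> t" for a b
      using small[OF that] norm_minus_cancel[of "a *\<^sub>R v + b *\<^sub>R w"]
      by (intro subsetD[OF r(2)]) (simp add: dist_norm)
    define \<psi> where "\<psi> a = g (x + (a *\<^sub>R v + t *\<^sub>R w)) - g (x + (a *\<^sub>R v + 0 *\<^sub>R w))" for a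
    have \<psi>': "(\<psi> has_derivative (\<lambda>h. h * (\<phi> (x + (a *\<^sub>R v + t *\<^sub>R w)) - \<phi> (x + (a *\<^sub>R v + 0 *\<^sub>R w))))) (at a)"
      if "0 \<le> a" "a \<le> t" for a
    proof -
      have *: "((\<lambda>a. g (x + (a *\<^sub>R v + b *\<^sub>R w))) has_derivative (\<lambda>h. h * \<phi> (x + (a *\<^sub>R v + b *\<^sub>R w)))) (at a)"
        if "0 \<le> b" "b \<le> t" for b
      proof -
        have df: "g differentiable (at (x + (a *\<^sub>R v + b *\<^sub>R w)))"
          using assms(3) inS \<open>0 \<le> a\<close> \<open>a \<le> t\<close> that by blast
        have "((\<lambda>a. g (x + (a *\<^sub>R v + b *\<^sub>R w))) has_derivative
               (\<lambda>h. fd g (x + (a *\<^sub>R v + b *\<^sub>R w)) (h *\<^sub>R v))) (at a)"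
          by (rule has_derivative_compose[where f = "\<lambda>a. x + (a *\<^sub>R v + b *\<^sub>R w)" and g = g])
            (auto intro!: derivative_eq_intros fd_works[OF df])
        then show ?thesis
          using linear_scale[OF fd_linear[OF df]] by (simp add: \<phi>_def)
      qed
      show ?thesis
        unfolding \<psi>_def using has_derivative_diff[OF *[of t] *[of 0]] t
        by (simp add: algebra_simps)
    qed
    have "\<exists>z\<in>{0<..<t}. \<psi> t - \<psi> 0 = (t - 0) * (\<phi> (x + (z *\<^sub>R v + t *\<^sub>R w)) - \<phi> (x + (z *\<^sub>R v + 0 *\<^sub>R w)))"
    proof (rule mvt[OF t(1), where f' = "\<lambda>a h. h * (\<phi> (x + (a *\<^sub>R v + t *\<^sub>R w)) - \<phi> (x + (a *\<^sub>R v + 0 *\<^sub>R w)))"])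
      show "continuous_on {0..t} \<psi>"
      proof (rule continuous_at_imp_continuous_on, rule ballI)
        fix a assume "a \<in> {0..t}"
        then show "isCont \<psi> a" using has_derivative_continuous[OF \<psi>'[of a]] by simp
      qed
    qed (rule \<psi>', auto)
    then obtain z where z: "0 < z" "z < t"
      and eq: "\<psi> t - \<psi> 0 = t * (\<phi> (x + (z *\<^sub>R v + t *\<^sub>R w)) - \<phi> (x + (z *\<^sub>R v + 0 *\<^sub>R w)))"
      by auto
    have D: "\<bar>\<phi> (x + (z *\<^sub>R v + b *\<^sub>R w)) - \<phi> x - d (z *\<^sub>R v + b *\<^sub>R w)\<bar> \<le> e / (2 * C) * (t * (norm v + norm w))"
      if "0 \<le> b" "b \<le> t" for b
    proof -
      have sm: "norm (z *\<^sub>R v + b *\<^sub>R w) < s" "norm (z *\<^sub>R v + b *\<^sub>R w) \<le> t * (norm v + norm w)"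
        using small[of z b] z that by auto
      have "\<bar>\<phi> (x + (z *\<^sub>R v + b *\<^sub>R w)) - \<phi> x - d (z *\<^sub>R v + b *\<^sub>R w)\<bar> \<le> e / (2 * C) * norm (z *\<^sub>R v + b *\<^sub>R w)"
        using s(2)[of "x + (z *\<^sub>R v + b *\<^sub>R w)"] sm by simp
      also have "\<dots> \<le> e / (2 * C) * (t * (norm v + norm w))"
        using sm \<open>e > 0\<close> C by (intro mult_left_mono) auto
      finally show ?thesis .
    qed
    have ds: "d (z *\<^sub>R v + t *\<^sub>R w) - d (z *\<^sub>R v + 0 *\<^sub>R w) = t * d w"
      by (simp add: linear_add[OF lin] linear_scale[OF lin])
    have "\<bar>\<phi> (x + (z *\<^sub>R v + t *\<^sub>R w)) - \<phi> (x + (z *\<^sub>R v + 0 *\<^sub>R w)) - t * d w\<bar>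
        \<le> 2 * (e / (2 * C) * (t * (norm v + norm w)))"
      using D[of t] D[of 0] t ds by linarith
    also have "\<dots> = e * t * ((norm v + norm w) / C)" using C by (simp add: field_simps)
    also have "\<dots> < e * t * 1"
    proof (intro mult_strict_left_mono)
      have "norm v + norm w < C" unfolding C_def by (smt (verit) norm_ge_zero)
      then show "(norm v + norm w) / C < 1" using C by simp
    qed (use \<open>e > 0\<close> t in auto)
    finally have less: "\<bar>\<phi> (x + (z *\<^sub>R v + t *\<^sub>R w)) - \<phi> (x + (z *\<^sub>R v + 0 *\<^sub>R w)) - t * d w\<bar> < e * t" by simp
    have "g (x + t *\<^sub>R v + t *\<^sub>R w) - g (x + t *\<^sub>R v) - g (x + t *\<^sub>R w) + g x = \<psi> t - \<psi> 0"
      by (simp add: \<psi>_def algebra_simps)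
    then have "(g (x + t *\<^sub>R v + t *\<^sub>R w) - g (x + t *\<^sub>R v) - g (x + t *\<^sub>R w) + g x) / t\<^sup>2 - d w
       = (\<phi> (x + (z *\<^sub>R v + t *\<^sub>R w)) - \<phi> (x + (z *\<^sub>R v + 0 *\<^sub>R w)) - t * d w) / t"
      unfolding eq using t by (simp add: power2_eq_square diff_divide_distrib)
    then show ?thesis using less t by (simp add: abs_divide pos_divide_less_eq)
  qed
  then show "\<forall>\<^sub>F t in at_right 0. dist ((g (x + t *\<^sub>R v + t *\<^sub>R w) - g (x + t *\<^sub>R v) - g (x + t *\<^sub>R w) + g x) / t\<^sup>2)
       (fd (\<lambda>y. fd g y v) x w) < e"
    using m unfolding eventually_at_right_field dist_real_def d_def \<phi>_def by blast
qed

lemma second_derivative_symmetric_real: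
  fixes g :: "'a::real_normed_vector \<Rightarrow> real"
  assumes "open S" "x \<in> S" "ck_on 2 S g"
  shows "fd (\<lambda>y. fd g y v) x w = fd (\<lambda>y. fd g y w) x v"
proof -
  have g: "g differentiable (at y)" "(\<lambda>y. fd g y v) differentiable (at y)" if "y \<in> S" for y v
    using assms(3) that by (auto simp: numeral_2_eq_2)
  have 1: "((\<lambda>t. (g (x + t *\<^sub>R v + t *\<^sub>R w) - g (x + t *\<^sub>R v) - g (x + t *\<^sub>R w) + g x) / t\<^sup>2)
            \<longlongrightarrow> fd (\<lambda>y. fd g y v) x w) (at_right 0)"
    by (rule second_difference_quotient_real[OF assms(1,2)]) (use g assms(2) in auto)
  have 2: "((\<lambda>t. (g (x + t *\<^sub>R w + t *\<^sub>R v) - g (x + t *\<^sub>R w) - g (x + t *\<^sub>R v) + g x) / t\<^sup>2)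
            \<longlongrightarrow> fd (\<lambda>y. fd g y w) x v) (at_right 0)"
    by (rule second_difference_quotient_real[OF assms(1,2)]) (use g assms(2) in auto)
  have "(\<lambda>t. (g (x + t *\<^sub>R w + t *\<^sub>R v) - g (x + t *\<^sub>R w) - g (x + t *\<^sub>R v) + g x) / t\<^sup>2) =
        (\<lambda>t. (g (x + t *\<^sub>R v + t *\<^sub>R w) - g (x + t *\<^sub>R v) - g (x + t *\<^sub>R w) + g x) / t\<^sup>2)"
    by (simp add: algebra_simps)
  then show ?thesis using tendsto_unique[OF _ 1] 2 by simp
qed

lemma fd_inner_const:
  assumes "f differentiable (at x)"
  shows "fd (\<lambda>x. f x \<bullet> b) x v = fd f x v \<bullet> b"
  using fd_eqI[OF has_derivative_inner_left[OF fd_works[OF assms], of b]] by metis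

text \<open>Schwarz's theorem, from the scalar case applied to each component.\<close>

lemma second_derivative_symmetric:
  fixes g :: "'a::real_normed_vector \<Rightarrow> 'b::euclidean_space"
  assumes "open S" "x \<in> S" "ck_on 2 S g"
  shows "fd (\<lambda>y. fd g y v) x w = fd (\<lambda>y. fd g y w) x v"
proof (rule euclidean_eqI)
  fix b :: 'b assume "b \<in> Basis"
  have g: "g differentiable (at y)" "(\<lambda>y. fd g y v) differentiable (at y)" if "y \<in> S" for y v
    using assms(3) that by (auto simp: numeral_2_eq_2)
  have *: "fd (\<lambda>y. fd (\<lambda>y. g y \<bullet> b) y v) x w = fd (\<lambda>y. fd g y v) x w \<bullet> b" for v w
  proof -
    have "fd (\<lambda>y. fd (\<lambda>y. g y \<bullet> b) y v) x w = fd (\<lambda>y. fd g y v \<bullet> b) x w"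
      using fd_cong[OF assms(1,2), of "\<lambda>y. fd (\<lambda>y. g y \<bullet> b) y v" "\<lambda>y. fd g y v \<bullet> b"]
        fd_inner_const g by metis
    then show ?thesis using fd_inner_const[OF g(2)[OF assms(2)]] by simp
  qed
  have "ck_on 2 S (\<lambda>y. g y \<bullet> b)"
    by (rule ck_on_inner[OF assms(1) assms(3) ck_on_const])
  from second_derivative_symmetric_real[OF assms(1,2) this, of v w] *
  show "fd (\<lambda>y. fd g y v) x w \<bullet> b = fd (\<lambda>y. fd g y w) x v \<bullet> b" by simp
qed

lemma max_imp_fd_eq_0:
  fixes g :: "'a::real_normed_vector \<Rightarrow> real"
  assumes "open S" "x \<in> S" "g differentiable (at x)" "\<And>y. y \<in> S \<Longrightarrow> g y \<le> g x"
  shows "fd g x v = 0"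
  using differential_zero_maxmin[OF assms(2,1) fd_works[OF assms(3)]] assms(4) by metis

text \<open>If the second derivative were positive, the first one, which vanishes at \<open>x\<close>, would be positive just
  beyond \<open>x\<close> on the line in direction \<open>v\<close>, and \<open>g\<close> would exceed its maximum there.\<close>

lemma max_imp_second_derivative_le_0:
  fixes g :: "'a::real_normed_vector \<Rightarrow> real"
  assumes "open S" "x \<in> S" "\<And>y. y \<in> S \<Longrightarrow> g differentiable (at y)"
    and "(\<lambda>y. fd g y v) differentiable (at x)" "\<And>y. y \<in> S \<Longrightarrow> g y \<le> g x"
  shows "fd (\<lambda>y. fd g y v) x v \<le> 0"
proof (rule ccontr)
  assume neg: "\<not> ?thesis"
  define \<phi> where "\<phi> y = fd g y v" for y
  have \<phi>0: "\<phi> x = 0" unfolding \<phi>_def using max_imp_fd_eq_0 assms by blast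
  have line: "((\<lambda>t. x + t *\<^sub>R v) has_derivative (\<lambda>h. h *\<^sub>R v)) (at t)" for t
    by (auto intro!: derivative_eq_intros)
  have d\<phi>: "\<phi> differentiable (at x)" using assms(4) unfolding \<phi>_def .
  have "((\<lambda>t. \<phi> (x + t *\<^sub>R v)) has_derivative (\<lambda>h. fd \<phi> x (h *\<^sub>R v))) (at 0)"
    by (rule has_derivative_compose[OF line]) (simp add: fd_works d\<phi>)
  then have "((\<lambda>t. \<phi> (x + t *\<^sub>R v)) has_real_derivative fd \<phi> x v) (at 0)"
    using linear_scale[OF fd_linear[OF d\<phi>]]
    by (simp add: has_field_derivative_def mult.commute[of _ "fd \<phi> x v"])
  moreover have "fd \<phi> x v > 0" using neg unfolding \<phi>_def by linarith
  ultimately obtain s where s: "s > 0" "\<And>h. 0 < h \<Longrightarrow> h < s \<Longrightarrow> \<phi> (x + h *\<^sub>R v) > 0"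
    using DERIV_pos_inc_right[of "\<lambda>t. \<phi> (x + t *\<^sub>R v)" "fd \<phi> x v" 0] \<phi>0 by auto
  obtain r where r: "r > 0" "ball x r \<subseteq> S" using assms(1,2) openE by blast
  define T where "T = min (s/2) (r / (2 * (norm v + 1)))"
  have nv: "norm v + 1 > 0" by (smt (verit) norm_ge_zero)
  have T: "T > 0" "T < s" using s r nv by (auto simp: T_def)
  have inS: "x + t *\<^sub>R v \<in> S" if "0 \<le> t" "t \<le> T" for t
  proof -
    have "t * norm v \<le> T * (norm v + 1)" using that by (intro mult_mono) auto
    also have "\<dots> \<le> r / (2 * (norm v + 1)) * (norm v + 1)" using nv by (intro mult_right_mono) (auto simp: T_def)
    also have "\<dots> = r / 2" using nv by (simp add: field_simps)
    also have "\<dots> < r" using r by simp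
    finally show ?thesis using that by (intro subsetD[OF r(2)]) (simp add: dist_norm)
  qed
  have der: "((\<lambda>t. g (x + t *\<^sub>R v)) has_derivative (\<lambda>h. h * \<phi> (x + t *\<^sub>R v))) (at t)" if "0 \<le> t" "t \<le> T" for t
  proof -
    have df: "g differentiable (at (x + t *\<^sub>R v))" using assms(3) inS that by blast
    show ?thesis
      using has_derivative_compose[where g = g, OF line fd_works[OF df]]
      by (simp add: linear_scale[OF fd_linear[OF df]] \<phi>_def)
  qed
  have "\<exists>z\<in>{0<..<T}. g (x + T *\<^sub>R v) - g (x + 0 *\<^sub>R v) = (T - 0) * \<phi> (x + z *\<^sub>R v)"
  proof (rule mvt[OF T(1), where f' = "\<lambda>z h. h * \<phi> (x + z *\<^sub>R v)"])
    show "continuous_on {0..T} (\<lambda>t. g (x + t *\<^sub>R v))"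
    proof (rule continuous_at_imp_continuous_on, rule ballI)
      fix a assume "a \<in> {0..T}"
      then show "isCont (\<lambda>t. g (x + t *\<^sub>R v)) a" using has_derivative_continuous[OF der[of a]] by simp
    qed
  qed (rule der, auto)
  then obtain z where "0 < z" "z < T" "g (x + T *\<^sub>R v) - g x = T * \<phi> (x + z *\<^sub>R v)" by auto
  moreover have "\<phi> (x + z *\<^sub>R v) > 0" using s(2) \<open>0 < z\<close> \<open>z < T\<close> T by auto
  ultimately have "g (x + T *\<^sub>R v) > g x" using T by (smt (verit) mult_pos_pos)
  then show False using assms(5) inS[of T] T by force
qed

section \<open>Linear algebra in \<open>\<real>\<^sup>3\<close>\<close>

text \<open>Cramer's rule for the vectors \<open>a\<close>, \<open>b\<close>, \<open>a \<times> b\<close>, without division.\<close>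

lemma cross3_decompose:
  fixes a b x :: "real^3"
  defines "N \<equiv> cross3 a b"
  shows "(N \<bullet> N) *\<^sub>R x = (cross3 x b \<bullet> N) *\<^sub>R a + (cross3 a x \<bullet> N) *\<^sub>R b + (x \<bullet> N) *\<^sub>R N"
  unfolding N_def by (simp add: cross3_simps forall_3)

lemma in_span_if_orthogonal_cross3:
  fixes a b x :: "real^3"
  assumes "cross3 a b \<noteq> 0" "x \<bullet> cross3 a b = 0"
  shows "x = (cross3 x b \<bullet> cross3 a b / (cross3 a b \<bullet> cross3 a b)) *\<^sub>R a +
             (cross3 a x \<bullet> cross3 a b / (cross3 a b \<bullet> cross3 a b)) *\<^sub>R b"
proof -
  let ?N = "cross3 a b"
  have "x = inverse (?N \<bullet> ?N) *\<^sub>R ((?N \<bullet> ?N) *\<^sub>R x)" using assms(1) by simp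
  also have "\<dots> = inverse (?N \<bullet> ?N) *\<^sub>R ((cross3 x b \<bullet> ?N) *\<^sub>R a + (cross3 a x \<bullet> ?N) *\<^sub>R b)"
    unfolding cross3_decompose using assms(2) by simp
  finally show ?thesis by (simp add: algebra_simps divide_inverse)
qed

lemma parallel_cross3_if_orthogonal:
  fixes a b n :: "real^3"
  assumes "cross3 a b \<noteq> 0" "n \<bullet> a = 0" "n \<bullet> b = 0"
  obtains s where "n = s *\<^sub>R cross3 a b"
proof
  let ?N = "cross3 a b"
  have "(?N \<bullet> ?N) *\<^sub>R n = (n \<bullet> ?N) *\<^sub>R ?N + (n \<bullet> a) *\<^sub>R cross3 b ?N - (n \<bullet> b) *\<^sub>R cross3 a ?N"
    by (simp add: cross3_simps forall_3)
  then have *: "(?N \<bullet> ?N) *\<^sub>R n = (n \<bullet> ?N) *\<^sub>R ?N" using assms by simp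
  have "n = inverse (?N \<bullet> ?N) *\<^sub>R ((?N \<bullet> ?N) *\<^sub>R n)" using assms(1) by simp
  then show "n = ((n \<bullet> ?N) / (?N \<bullet> ?N)) *\<^sub>R ?N"
    unfolding * by (simp add: divide_inverse mult.commute)
qed

lemma cross3_nonzero_if_independent:
  fixes a b :: "real^3"
  assumes "\<And>s t. s *\<^sub>R a + t *\<^sub>R b = 0 \<Longrightarrow> s = 0 \<and> t = 0"
  shows "cross3 a b \<noteq> 0"
proof
  assume N: "cross3 a b = 0"
  \<comment> \<open>The triple product \<open>a \<times> (a \<times> b)\<close> is a linear relation between \<open>a\<close> and \<open>b\<close>.\<close>
  have "(a \<bullet> b) *\<^sub>R a + (- (a \<bullet> a)) *\<^sub>R b = cross3 a (cross3 a b)"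
    by (simp add: cross3_simps forall_3)
  then have "a = 0" using assms N by (metis cross_zero_right neg_equal_0_iff_equal inner_eq_zero_iff)
  then show False using assms[of 1 0] by simp
qed

lemma vec2_eq: "v = (v $ 1) *\<^sub>R axis 1 1 + (v $ 2) *\<^sub>R axis 2 (1::real)" for v :: "real^2"
  by (simp add: vec_eq_iff forall_2 axis_def)

lemma linear_vec2:
  fixes d :: "real^2 \<Rightarrow> 'b::real_vector"
  assumes "linear d"
  shows "d v = (v $ 1) *\<^sub>R d (axis 1 1) + (v $ 2) *\<^sub>R d (axis 2 1)"
proof -
  have "d v = d ((v $ 1) *\<^sub>R axis 1 1 + (v $ 2) *\<^sub>R axis 2 1)" using vec2_eq[of v] by simp
  then show ?thesis by (simp only: linear_add[OF assms] linear_scale[OF assms])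
qed

lemma cross3_partial_nonzero:
  assumes "F differentiable (at u)" "inj (fd F u)"
  shows "cross3 (partial 1 F u) (partial 2 F u) \<noteq> 0"
proof (rule cross3_nonzero_if_independent)
  fix s t assume 0: "s *\<^sub>R partial 1 F u + t *\<^sub>R partial 2 F u = 0"
  have lin: "linear (fd F u)" by (rule fd_linear[OF assms(1)])
  define v :: "real^2" where "v = s *\<^sub>R axis 1 1 + t *\<^sub>R axis 2 1"
  have "fd F u v = 0" using 0 unfolding v_def partial_def by (simp add: linear_add[OF lin] linear_scale[OF lin])
  then have "v = 0" using assms(2) linear_0[OF lin] by (metis injD)
  then have "v $ 1 = 0" "v $ 2 = 0" by simp_all
  then show "s = 0 \<and> t = 0" unfolding v_def by (simp add: axis_def)
qed

text \<open>Let a \<open>2 \<times> 2\<close> matrix with off-diagonal entries \<open>x\<close>, \<open>y\<close> and difference \<open>z\<close> of its diagonal entries be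
  self-adjoint for the definite form \<open>b\<close>; this is the second hypothesis. Then \<open>z\<^sup>2 + 4 x y\<close> is the
  discriminant of its characteristic polynomial. Only opposite signs of \<open>x\<close> and \<open>y\<close> could make it
  negative, but then \<open>(b12 z)\<^sup>2 \<ge> - 4 b11 b22 x y > - 4 b12\<^sup>2 x y\<close>.\<close>

lemma selfadjoint_discriminant:
  fixes b11 b12 b22 x y z :: real
  assumes "b12\<^sup>2 < b11 * b22" "b11 * x - b22 * y = b12 * z"
  shows "0 \<le> z\<^sup>2 + 4 * x * y" "z\<^sup>2 + 4 * x * y = 0 \<Longrightarrow> x = 0 \<and> y = 0 \<and> z = 0"
proof -
  have *: "0 \<le> z\<^sup>2 + 4 * x * y \<and> (z\<^sup>2 + 4 * x * y = 0 \<longrightarrow> x = 0 \<and> y = 0 \<and> z = 0)"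
  proof (cases "x * y < 0")
    case True
    have "(b12 * z)\<^sup>2 = (b11 * x + b22 * y)\<^sup>2 - 4 * (b11 * b22) * (x * y)"
      unfolding assms(2)[symmetric] by (simp add: power2_eq_square algebra_simps)
    then have 1: "b12\<^sup>2 * z\<^sup>2 \<ge> 4 * (b11 * b22) * (- (x * y))"
      by (simp add: power_mult_distrib)
    have 2: "4 * (b11 * b22) * (- (x * y)) > 4 * b12\<^sup>2 * (- (x * y))"
      using True assms(1) by (intro mult_strict_right_mono) auto
    have "b12\<^sup>2 * (z\<^sup>2 + 4 * (x * y)) > 0" using 1 2 by (simp add: algebra_simps)
    then have "z\<^sup>2 + 4 * (x * y) > 0"
      by (metis zero_less_mult_pos2 zero_le_power2 mult_nonneg_nonpos not_less)
    then show ?thesis by (auto simp: mult.assoc)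
  next
    case False
    then have xy: "x * y \<ge> 0" by simp
    have nn: "0 \<le> z\<^sup>2 + 4 * (x * y)" using xy by simp
    have "x = 0 \<and> y = 0 \<and> z = 0" if "z\<^sup>2 + 4 * (x * y) = 0"
    proof -
      have z: "z = 0" and "x * y = 0" using that xy zero_le_power2[of z] by (auto simp: add_nonneg_eq_0_iff)
      have "b11 \<noteq> 0" "b22 \<noteq> 0" using assms(1) zero_le_power2[of b12] by auto
      then show ?thesis using z \<open>x * y = 0\<close> assms(2) by auto
    qed
    then show ?thesis using nn by (auto simp: mult.assoc)
  qed
  show "0 \<le> z\<^sup>2 + 4 * x * y" using * by blast
  show "z\<^sup>2 + 4 * x * y = 0 \<Longrightarrow> x = 0 \<and> y = 0 \<and> z = 0" using * by blast
qed

section \<open>The second fundamental form of the unit sphere\<close>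

lemma bounded_linear_Pair_left: "linear L \<Longrightarrow> bounded_linear (\<lambda>y. L (y, 0))"
  for L :: "(real^2) \<times> real \<Rightarrow> real^3"
  using bounded_linear_compose[OF linear_conv_bounded_linear[THEN iffD1]
      bounded_linear_Pair[OF bounded_linear_ident bounded_linear_zero]] by blast

lemma smooth_on_graph:
  fixes L :: "(real^2) \<times> real \<Rightarrow> real^3"
  assumes "linear L" "open U" "smooth_on U h"
  shows "smooth_on U (\<lambda>y. L (y, h y))"
proof -
  have "L (y, h y) = L (y, 0) + h y *\<^sub>R L (0, 1)" for y
    using linear_add[OF assms(1), of "(y, 0)" "(0, h y)"] linear_scale[OF assms(1), of "h y" "(0, 1)"] by simp
  then show ?thesis
    using assms bounded_linear_Pair_left[OF assms(1)] unfolding smooth_on_def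
    by (auto intro!: ck_on_add ck_on_scaleR ck_on_const ck_on_linear[where L = "\<lambda>y. L (y, 0)"] ck_on_ident)
qed

lemma fd_graph:
  fixes L :: "(real^2) \<times> real \<Rightarrow> real^3"
  assumes "linear L" "h differentiable (at y)"
  shows "fd (\<lambda>y. L (y, h y)) y v = L (v, fd h y v)"
proof -
  have "bounded_linear L" using assms(1) linear_conv_bounded_linear by blast
  then have "((\<lambda>y. L (y, h y)) has_derivative (\<lambda>v. L (v, fd h y v))) (at y)"
    by (rule bounded_linear.has_derivative[OF _ has_derivative_Pair[OF has_derivative_ident fd_works[OF assms(2)]]])
  then show ?thesis by (rule fd_apply_eqI)
qed

lemma graph_regular_patch:
  fixes L :: "(real^2) \<times> real \<Rightarrow> real^3"
  assumes "linear L" "inj L" "open U" "smooth_on U h" "(\<lambda>u. L (u, h u)) ` U \<subseteq> S"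
  shows "regular_patch S U (\<lambda>u. L (u, h u))"
  unfolding regular_patch_def
proof (intro conjI ballI assms smooth_on_graph)
  show "inj_on (\<lambda>u. L (u, h u)) U" using assms(2) by (auto simp: inj_on_def dest!: injD)
  fix u assume "u \<in> U"
  have h: "h differentiable (at u)" using smooth_on_differentiable[OF assms(4) \<open>u \<in> U\<close>] .
  have r: "(\<lambda>u. L (u, h u)) differentiable (at u)"
    using smooth_on_differentiable[OF smooth_on_graph[OF assms(1,3,4)] \<open>u \<in> U\<close>] .
  show "cross3 (partial 1 (\<lambda>u. L (u, h u)) u) (partial 2 (\<lambda>u. L (u, h u)) u) \<noteq> 0"
  proof (rule cross3_partial_nonzero[OF r])
    show "inj (fd (\<lambda>u. L (u, h u)) u)"
      using assms(2) by (auto simp: fd_graph[OF assms(1) h] inj_def)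
  qed
qed

lemma fd_inner_eq_0:
  assumes "open S" "x \<in> S" "f differentiable (at x)" "g differentiable (at x)"
    and "\<And>y. y \<in> S \<Longrightarrow> f y \<bullet> g y = 0"
  shows "fd f x v \<bullet> g x + f x \<bullet> fd g x v = (0::real)"
proof -
  have "((\<lambda>y. f y \<bullet> g y) has_derivative (\<lambda>v. f x \<bullet> fd g x v + fd f x v \<bullet> g x)) (at x)"
    by (intro has_derivative_inner fd_works assms)
  then have "fd (\<lambda>y. f y \<bullet> g y) x v = f x \<bullet> fd g x v + fd f x v \<bullet> g x" by (rule fd_apply_eqI)
  moreover have "fd (\<lambda>y. f y \<bullet> g y) x = fd (\<lambda>y. 0) x"
    by (rule fd_cong[OF assms(1,2)]) (rule assms(5))
  ultimately show ?thesis by (simp add: frechet_derivative_const)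
qed

text \<open>The second fundamental form with respect to the normal \<open>r\<^sub>1 \<times> r\<^sub>2\<close>, which, unlike the unit normal, is a
  polynomial in the derivatives of \<open>r\<close>.\<close>

definition shape_form :: "(real^2 \<Rightarrow> real^3) \<Rightarrow> real^2 \<Rightarrow> real^2 \<Rightarrow> real^2 \<Rightarrow> real" where
  "shape_form r y v w = cross3 (partial 1 r y) (partial 2 r y) \<bullet> fd (\<lambda>z. fd r z w) y v"

lemma shape_form_linear:
  assumes "open U" "smooth_on U r" "y \<in> U"
  shows "linear (\<lambda>v. shape_form r y v w)"
proof -
  have "linear (fd (\<lambda>z. fd r z w) y)"
    using fd_linear[OF smooth_on_differentiable[OF smooth_on_fd[OF assms(2)] assms(3)]] .
  then show ?thesis unfolding shape_form_def
    by (auto intro!: linearI simp: linear_add linear_scale inner_add_right)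
qed

lemma shape_form_commute:
  assumes "open U" "smooth_on U r" "y \<in> U"
  shows "shape_form r y v w = shape_form r y w v"
  unfolding shape_form_def
  using second_derivative_symmetric[OF assms(1,3) smooth_onD[OF assms(2)]] by metis

text \<open>In the basis of coordinate vectors, \<open>shape_form r y\<close> is the matrix of the second fundamental form
  multiplied by the length of the normal, and its determinant has the sign of the Gaussian
  curvature. Completing the square gives definiteness; \<open>\<sigma>\<close> is the sign of the form.\<close>

lemma shape_form_definite:
  assumes "regular_patch S U r" "positive_gauss_curvature S" "y \<in> U"
  obtains \<sigma> :: real where "\<bar>\<sigma>\<bar> = 1" "\<And>v. v \<noteq> 0 \<Longrightarrow> \<sigma> * shape_form r y v v > 0"
proof -
  let ?e1 = "axis 1 1 :: real^2" and ?e2 = "axis 2 1 :: real^2"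
  let ?N = "cross3 (partial 1 r y) (partial 2 r y)"
  define B where "B = shape_form r y"
  from assms have U: "open U" "smooth_on U r" and N: "?N \<noteq> 0"
    unfolding regular_patch_def by auto
  have sf: "second_form r y i j = B (axis i 1) (axis j 1) / norm ?N" for i j
    unfolding second_form_def B_def shape_form_def unit_normal_def partial_def
    by (simp add: sgn_div_norm inner_commute divide_inverse mult.commute)
  have gram: "first_form r y 1 1 * first_form r y 2 2 - (first_form r y 1 2)\<^sup>2 = (norm ?N)\<^sup>2"
    using norm_cross_dot[of "partial 1 r y" "partial 2 r y"]
    by (simp add: first_form_def power_mult_distrib dot_square_norm)
  have "0 < euclidean_gauss_curvature r y" using assms unfolding positive_gauss_curvature_def by blast
  then have "0 < (second_form r y 1 1 * second_form r y 2 2 - (second_form r y 1 2)\<^sup>2)"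
    unfolding euclidean_gauss_curvature_def gram using N by (simp add: zero_less_divide_iff)
  also have "\<dots> = (B ?e1 ?e1 * B ?e2 ?e2 - (B ?e1 ?e2)\<^sup>2) / (norm ?N)\<^sup>2"
    unfolding sf by (simp add: power2_eq_square diff_divide_distrib)
  finally have det: "B ?e1 ?e1 * B ?e2 ?e2 - (B ?e1 ?e2)\<^sup>2 > 0"
    using N by (simp add: zero_less_divide_iff)
  define b11 b12 b22 where "b11 = B ?e1 ?e1" and "b12 = B ?e1 ?e2" and "b22 = B ?e2 ?e2"
  have det': "b11 * b22 - b12\<^sup>2 > 0" using det unfolding b11_def b12_def b22_def .
  have exp: "B v v = (v$1)\<^sup>2 * b11 + 2 * (v$1) * (v$2) * b12 + (v$2)\<^sup>2 * b22" for v
  proof -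
    have lin: "linear (\<lambda>v. B v w)" for w unfolding B_def by (rule shape_form_linear[OF U assms(3)])
    have sym: "B v w = B w v" for v w unfolding B_def by (rule shape_form_commute[OF U assms(3)])
    have "B v v = v$1 * B ?e1 v + v$2 * B ?e2 v" using linear_vec2[OF lin, of v v] by simp
    moreover have "B ?e1 v = v$1 * B ?e1 ?e1 + v$2 * B ?e1 ?e2"
      using linear_vec2[OF lin, of v ?e1] sym by simp
    moreover have "B ?e2 v = v$1 * B ?e1 ?e2 + v$2 * B ?e2 ?e2"
      using linear_vec2[OF lin, of v ?e2] sym by simp
    ultimately show ?thesis by (simp add: b11_def b12_def b22_def power2_eq_square algebra_simps)
  qed
  have b11: "b11 \<noteq> 0" using det' by auto
  show ?thesis
  proof
    show "\<bar>sgn b11\<bar> = 1" using b11 by (simp add: abs_sgn_eq)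
    fix v :: "real^2" assume "v \<noteq> 0"
    then have v: "v$1 \<noteq> 0 \<or> v$2 \<noteq> 0" by (auto simp: vec_eq_iff forall_2)
    have eq: "b11 * B v v = (b11 * v$1 + b12 * v$2)\<^sup>2 + (b11 * b22 - b12\<^sup>2) * (v$2)\<^sup>2"
      unfolding exp by (simp add: power2_eq_square algebra_simps)
    have "b11 * B v v > 0"
    proof (cases "v$2 = 0")
      case True
      then show ?thesis unfolding eq using v b11 by simp
    next
      case False
      then show ?thesis unfolding eq using det' by (intro add_nonneg_pos) auto
    qed
    then show "sgn b11 * shape_form r y v v > 0"
      unfolding B_def[symmetric] by (simp add: zero_less_mult_iff)
  qed
qed

text \<open>Write \<open>m\<close> for the normal \<open>r\<^sub>1 \<times> r\<^sub>2\<close> of a graph patch \<open>r\<close> of \<open>S\<close>, and \<open>E = r \<circ> Y\<close>. Differentiating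
  \<open>m \<bullet> dr = 0\<close> on the patch and \<open>(m \<circ> Y) \<bullet> dF = 0\<close> on the surface, and comparing, expresses the form
  \<open>m \<bullet> d\<^sup>2r\<close>, evaluated on the images of \<open>dE\<close> and \<open>dF\<close>, through \<open>m \<bullet> d\<^sup>2F\<close>. The former is definite and the
  latter symmetric. So, with \<open>\<beta>\<close> the form \<open>m \<bullet> d\<^sup>2r\<close> transported to the parameter plane of \<open>F\<close>, the last
  property says that the endomorphism \<open>dF\<^sup>-\<^sup>1 \<circ> dE\<close> is self-adjoint for \<open>\<beta>\<close>, and that \<open>\<beta>\<close> turns it
  into the second fundamental form of the surface.\<close>

lemma birkhoff_shape_operator_selfadjoint:
  fixes S :: "(real^3) set" and F E :: "real^2 \<Rightarrow> real^3"
  assumes S: "locally_smooth_graph S" "positive_gauss_curvature S"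
    and U: "open U" "u \<in> U" "smooth_on U F" "smooth_on U E" "E ` U \<subseteq> S"
    and inj: "inj (fd F u)"
    and supp: "\<And>x. x \<in> U \<Longrightarrow> \<exists>n. n \<noteq> 0 \<and> (\<forall>w. n \<bullet> fd F x w = 0) \<and> (\<forall>z\<in>S. n \<bullet> z \<le> n \<bullet> E x)"
  obtains m \<beta> where "m \<noteq> 0" "\<And>w. m \<bullet> fd F u w = 0"
    "\<And>w. linear (\<lambda>v. \<beta> v w)" "\<And>v w. \<beta> v w = \<beta> w v" "\<And>v. v \<noteq> 0 \<Longrightarrow> 0 < \<beta> v v"
    "\<And>v v' w. fd E u v = fd F u v' \<Longrightarrow> \<beta> v' w = m \<bullet> fd (\<lambda>x. fd F x w) u v"
proof -
  have "E u \<in> S" using U by auto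
  then obtain W and L :: "(real^2) \<times> real \<Rightarrow> real^3" and G and h :: "real^2 \<Rightarrow> real"
    where W: "open W" "E u \<in> W" and L: "linear L" "\<And>z. norm (L z) = norm z"
      and G: "open G" "smooth_on G h" "S \<inter> W = (\<lambda>u. L (u, h u)) ` G"
    using S(1) unfolding locally_smooth_graph_def by meson
  have injL: "inj L"
    by (rule linear_injective_0[OF L(1), THEN iffD2]) (metis L(2) norm_eq_zero)
  obtain g where g: "linear g" "g \<circ> L = id" using linear_injective_left_inverse[OF L(1) injL] by blast
  then have gL: "g (L z) = z" for z by (metis comp_apply id_apply)
  define r where "r y = L (y, h y)" for y
  define P where "P x = fst (g x)" for x
  have linP: "linear P" unfolding P_def using g(1)
    by (auto intro!: linearI simp: linear_add linear_scale)
  then have blP: "bounded_linear P" by (simp add: linear_conv_bounded_linear)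
  have r: "regular_patch S G r"
    unfolding r_def by (rule graph_regular_patch[OF L(1) injL G(1,2)]) (use G(3) in auto)
  then have sr: "smooth_on G r" unfolding regular_patch_def by blast
  have Pr: "P (fd r y w) = w" if "y \<in> G" for y w
    using fd_graph[OF L(1) smooth_on_differentiable[OF G(2) that], of w] gL
    unfolding r_def P_def by simp
  define Y where "Y x = P (E x)" for x
  define U' where "U' = U \<inter> E -` W"
  have U': "open U'" "u \<in> U'" "U' \<subseteq> U"
    unfolding U'_def using continuous_open_preimage[OF smooth_on_continuous[OF U(4)] U(1) W(1)] U W by auto
  have Y: "Y x \<in> G" "r (Y x) = E x" if "x \<in> U'" for x
  proof -
    have "E x \<in> S \<inter> W" using that U(5) by (auto simp: U'_def)
    then obtain y where y: "y \<in> G" "E x = L (y, h y)" unfolding G(3) by auto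
    then have "Y x = y" using gL by (simp add: Y_def P_def)
    then show "Y x \<in> G" "r (Y x) = E x" using y by (simp_all add: r_def)
  qed
  define m where "m y = cross3 (partial 1 r y) (partial 2 r y)" for y
  have m0: "m y \<noteq> 0" if "y \<in> G" for y using r that unfolding regular_patch_def m_def by blast
  have sm: "smooth_on G m" unfolding smooth_on_def m_def partial_def
    by (intro allI ck_on_cross3 G(1) smooth_onD[OF smooth_on_fd[OF sr]])
  have mr: "m y \<bullet> fd r y w = 0" if "y \<in> G" for y w
  proof -
    have "linear (fd r y)" using fd_linear[OF smooth_on_differentiable[OF sr that]] .
    from linear_vec2[OF this, of w] show ?thesis
      unfolding m_def partial_def by (simp add: inner_add_right dot_cross_self)
  qed
  \<comment> \<open>The supporting normal \<open>n\<close> at \<open>E x\<close> is normal both to the surface and, by maximality, to the patch \<open>r\<close>.\<close>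
  have mF: "m (Y x) \<bullet> fd F x w = 0" if x: "x \<in> U'" for x w
  proof -
    obtain n where n: "n \<noteq> 0" "\<And>w. n \<bullet> fd F x w = 0" "\<And>z. z \<in> S \<Longrightarrow> n \<bullet> z \<le> n \<bullet> E x"
      using supp x U' by blast
    have dr: "r differentiable (at (Y x))" using smooth_on_differentiable[OF sr Y(1)[OF x]] .
    have "n \<bullet> fd r (Y x) w = 0" for w
    proof -
      have "fd (\<lambda>y. r y \<bullet> n) (Y x) w = 0"
      proof (rule max_imp_fd_eq_0[OF G(1) Y(1)[OF x]])
        show "(\<lambda>y. r y \<bullet> n) differentiable (at (Y x))" by (intro differentiable_inner dr differentiable_const)
        show "r y \<bullet> n \<le> r (Y x) \<bullet> n" if "y \<in> G" for y
          using n(3)[of "r y"] r that Y(2)[OF x] unfolding regular_patch_def by (auto simp: inner_commute)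
      qed
      then show ?thesis using fd_inner_const[OF dr] by (simp add: inner_commute)
    qed
    then obtain s where "n = s *\<^sub>R m (Y x)"
      using parallel_cross3_if_orthogonal[OF m0[OF Y(1)[OF x], unfolded m_def], of n]
      unfolding m_def partial_def by metis
    then show ?thesis using n(1) n(2)[of w] by auto
  qed
  define y where "y = Y u"
  have y: "y \<in> G" using Y(1) U' by (simp add: y_def)
  have dE: "E differentiable (at u)" and dF: "F differentiable (at u)"
    using smooth_on_differentiable U by blast+
  have DY: "(Y has_derivative (\<lambda>v. P (fd E u v))) (at u)"
    unfolding Y_def by (rule bounded_linear.has_derivative[OF blP fd_works[OF dE]])
  have dr: "r differentiable (at y)" and dm: "m differentiable (at y)"
    using smooth_on_differentiable[OF sr y] smooth_on_differentiable[OF sm y] .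
  have Fr: "fd F u w = fd r y (P (fd F u w))" for w
  proof -
    have "fd F u w \<bullet> cross3 (partial 1 r y) (partial 2 r y) = 0"
      using mF[OF U'(2), of w] by (simp add: m_def y_def inner_commute)
    from in_span_if_orthogonal_cross3[OF _ this] m0[OF y] obtain s t
      where "fd F u w = s *\<^sub>R partial 1 r y + t *\<^sub>R partial 2 r y" unfolding m_def by blast
    also have "\<dots> = fd r y (s *\<^sub>R axis 1 1 + t *\<^sub>R axis 2 1)"
      unfolding partial_def using fd_linear[OF dr] by (simp add: linear_add linear_scale)
    finally show ?thesis using Pr[OF y] by simp
  qed
  \<comment> \<open>Both sides equal minus the derivative of \<open>m\<close> along \<open>dE v\<close>, paired with \<open>dF w\<close>.\<close>
  have key: "shape_form r y (P (fd E u v)) (P (fd F u w)) = m y \<bullet> fd (\<lambda>x. fd F x w) u v" for v w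
  proof -
    define k where "k = P (fd E u v)"
    have "fd m y k \<bullet> fd r y (P (fd F u w)) + m y \<bullet> fd (\<lambda>z. fd r z (P (fd F u w))) y k = 0"
      by (rule fd_inner_eq_0[OF G(1) y dm]) (auto intro: mr smooth_on_differentiable[OF smooth_on_fd[OF sr] y])
    moreover have Dm: "((\<lambda>x. m (Y x)) has_derivative (\<lambda>v. fd m y (P (fd E u v)))) (at u)"
      using has_derivative_compose[OF DY, of m "fd m y"] fd_works[OF dm] by (simp add: y_def)
    have "fd (\<lambda>x. m (Y x)) u v \<bullet> fd F u w + m (Y u) \<bullet> fd (\<lambda>x. fd F x w) u v = 0"
      by (rule fd_inner_eq_0[OF U'(1,2)])
        (use Dm mF in \<open>auto intro: differentiableI smooth_on_differentiable[OF smooth_on_fd[OF U(3)] U(2)]\<close>)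
    then have "fd m y k \<bullet> fd F u w + m y \<bullet> fd (\<lambda>x. fd F x w) u v = 0"
      unfolding fd_eqI[OF Dm] k_def y_def .
    ultimately show ?thesis
      unfolding shape_form_def k_def[symmetric] m_def[symmetric] Fr[symmetric] by linarith
  qed
  obtain \<sigma> :: real where \<sigma>: "\<bar>\<sigma>\<bar> = 1" "\<And>v. v \<noteq> 0 \<Longrightarrow> \<sigma> * shape_form r y v v > 0"
    using shape_form_definite[OF r S(2) y] by blast
  define \<beta> where "\<beta> v w = \<sigma> * shape_form r y (P (fd F u v)) (P (fd F u w))" for v w
  show ?thesis
  proof (rule that[of "\<sigma> *\<^sub>R m y" \<beta>])
    show "\<sigma> *\<^sub>R m y \<noteq> 0" using \<sigma>(1) m0[OF y] by auto
    show "(\<sigma> *\<^sub>R m y) \<bullet> fd F u w = 0" for w using mF[OF U'(2)] by (simp add: y_def)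
    show "linear (\<lambda>v. \<beta> v w)" for w
    proof -
      have "linear (\<lambda>v. P (fd F u v))"
        using linear_compose[OF fd_linear[OF dF] linP] by (simp add: o_def)
      from linear_compose[OF this shape_form_linear[OF G(1) sr y]]
      have "linear (\<lambda>v. shape_form r y (P (fd F u v)) (P (fd F u w)))" by (simp add: o_def)
      from linear_compose_scale_right[OF this, of \<sigma>] show ?thesis unfolding \<beta>_def by simp
    qed
    show "\<beta> v w = \<beta> w v" for v w
      unfolding \<beta>_def by (simp add: shape_form_commute[OF G(1) sr y, of "P (fd F u v)"])
    show "0 < \<beta> v v" if "v \<noteq> 0" for v
    proof -
      have "P (fd F u v) \<noteq> 0"
      proof
        assume "P (fd F u v) = 0"
        then have "fd F u v = fd F u 0"
          using Fr[of v] linear_0[OF fd_linear[OF dr]] linear_0[OF fd_linear[OF dF]] by simp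
        then show False using injD[OF inj] that by blast
      qed
      then show ?thesis unfolding \<beta>_def using \<sigma>(2) by blast
    qed
    show "\<beta> v' w = (\<sigma> *\<^sub>R m y) \<bullet> fd (\<lambda>x. fd F x w) u v" if "fd E u v = fd F u v'" for v v' w
      unfolding \<beta>_def that[symmetric] key by simp
  qed
qed

section \<open>Principal curvatures in a parametrization\<close>

definition normal_cross :: "(real^2 \<Rightarrow> real^3) \<Rightarrow> real^2 \<Rightarrow> real^3" where
  "normal_cross F u = cross3 (partial 1 F u) (partial 2 F u)"

text \<open>Determinant and trace of \<open>d\<eta>\<close> as smooth functions of \<open>u\<close>, from \<open>E\<^sub>1 \<times> E\<^sub>2 = det (F\<^sub>1 \<times> F\<^sub>2)\<close> and
  \<open>E\<^sub>1 \<times> F\<^sub>2 + F\<^sub>1 \<times> E\<^sub>2 = trace (F\<^sub>1 \<times> F\<^sub>2)\<close>.\<close>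

definition shape_det :: "(real^2 \<Rightarrow> real^3) \<Rightarrow> (real^2 \<Rightarrow> real^3) \<Rightarrow> real^2 \<Rightarrow> real" where
  "shape_det F E u = (cross3 (partial 1 E u) (partial 2 E u) \<bullet> normal_cross F u) /
     (normal_cross F u \<bullet> normal_cross F u)"

definition shape_trace :: "(real^2 \<Rightarrow> real^3) \<Rightarrow> (real^2 \<Rightarrow> real^3) \<Rightarrow> real^2 \<Rightarrow> real" where
  "shape_trace F E u = ((cross3 (partial 1 E u) (partial 2 F u) + cross3 (partial 1 F u) (partial 2 E u))
     \<bullet> normal_cross F u) / (normal_cross F u \<bullet> normal_cross F u)"

definition shape_disc :: "(real^2 \<Rightarrow> real^3) \<Rightarrow> (real^2 \<Rightarrow> real^3) \<Rightarrow> real^2 \<Rightarrow> real" where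
  "shape_disc F E u = (shape_trace F E u)\<^sup>2 - 4 * shape_det F E u"

definition kappa1 :: "(real^2 \<Rightarrow> real^3) \<Rightarrow> (real^2 \<Rightarrow> real^3) \<Rightarrow> real^2 \<Rightarrow> real" where
  "kappa1 F E u = (shape_trace F E u + sqrt (shape_disc F E u)) / 2"

definition kappa2 :: "(real^2 \<Rightarrow> real^3) \<Rightarrow> (real^2 \<Rightarrow> real^3) \<Rightarrow> real^2 \<Rightarrow> real" where
  "kappa2 F E u = (shape_trace F E u - sqrt (shape_disc F E u)) / 2"

text \<open>The vector \<open>v\<close> with \<open>dF v = V\<close> for a tangent field \<open>V\<close>, by Cramer's rule, so that smoothness is apparent.\<close>

definition tangent_coords :: "(real^2 \<Rightarrow> real^3) \<Rightarrow> (real^2 \<Rightarrow> real^3) \<Rightarrow> real^2 \<Rightarrow> real^2" where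
  "tangent_coords F V u =
     (cross3 (V u) (partial 2 F u) \<bullet> normal_cross F u / (normal_cross F u \<bullet> normal_cross F u)) *\<^sub>R axis 1 1 +
     (cross3 (partial 1 F u) (V u) \<bullet> normal_cross F u / (normal_cross F u \<bullet> normal_cross F u)) *\<^sub>R axis 2 1"

text \<open>Evaluate the form at \<open>(- b12, b11)\<close>, where its value is \<open>b11 (b11 b22 - b12\<^sup>2)\<close>.\<close>

lemma positive_form_det:
  fixes \<beta> :: "real^2 \<Rightarrow> real^2 \<Rightarrow> real"
  assumes lin: "\<And>w. linear (\<lambda>v. \<beta> v w)" and sym: "\<And>v w. \<beta> v w = \<beta> w v"
    and pos: "\<And>v. v \<noteq> 0 \<Longrightarrow> 0 < \<beta> v v"
  shows "(\<beta> (axis 1 1) (axis 2 1))\<^sup>2 < \<beta> (axis 1 1) (axis 1 1) * \<beta> (axis 2 1) (axis 2 1)"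
proof -
  let ?e1 = "axis 1 1 :: real^2" and ?e2 = "axis 2 1 :: real^2"
  define b11 b12 b22 where b: "b11 = \<beta> ?e1 ?e1" "b12 = \<beta> ?e1 ?e2" "b22 = \<beta> ?e2 ?e2"
  have b11: "b11 > 0" unfolding b by (rule pos) (simp add: axis_eq_0_iff)
  define v :: "real^2" where "v = (- b12) *\<^sub>R ?e1 + b11 *\<^sub>R ?e2"
  have "v $ 2 = b11" by (simp add: v_def axis_def)
  then have "v \<noteq> 0" using b11 by auto
  then have "0 < \<beta> v v" by (rule pos)
  also have "\<beta> v v = - b12 * \<beta> v ?e1 + b11 * \<beta> v ?e2"
  proof -
    have "\<beta> v v = - b12 * \<beta> ?e1 v + b11 * \<beta> ?e2 v"
      by (subst (1) v_def) (simp add: linear_add[OF lin] linear_scale[OF lin] linear_diff[OF lin] linear_neg[OF lin])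
    then show ?thesis using sym by simp
  qed
  also have "\<beta> v ?e1 = - b12 * b11 + b11 * b12"
    unfolding v_def b by (simp add: linear_add[OF lin] linear_scale[OF lin] linear_diff[OF lin] linear_neg[OF lin] sym[of ?e2 ?e1])
  also have "\<beta> v ?e2 = - b12 * b12 + b11 * b22"
    unfolding v_def b by (simp add: linear_add[OF lin] linear_scale[OF lin] linear_diff[OF lin] linear_neg[OF lin])
  finally have "0 < b11 * (b11 * b22 - b12\<^sup>2)" by (simp add: power2_eq_square algebra_simps)
  then show ?thesis using b11 unfolding b[symmetric] by (simp add: zero_less_mult_iff)
qed

lemma smooth_on_partial: "smooth_on U F \<Longrightarrow> ck_on k U (partial i F)"
  using smooth_onD[OF smooth_on_fd[of U F "axis i 1"]] unfolding partial_def .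

lemma fd_partial:
  assumes "F differentiable (at u)"
  shows "fd F u v = (v $ 1) *\<^sub>R partial 1 F u + (v $ 2) *\<^sub>R partial 2 F u"
  unfolding partial_def by (rule linear_vec2[OF fd_linear[OF assms]])

text \<open>A coordinate expression \<open>F\<close> of the immersion and \<open>E\<close> of its Birkhoff normal field, with values in the
  unit sphere \<open>S\<close>. The last assumption is Birkhoff orthogonality: the tangent plane of \<open>F\<close>, moved to
  \<open>E x\<close>, supports \<open>S\<close>.\<close>

locale birkhoff_patch =
  fixes S :: "(real^3) set" and U :: "(real^2) set" and F E :: "real^2 \<Rightarrow> real^3"
  assumes graph: "locally_smooth_graph S" and curv: "positive_gauss_curvature S"
    and open_U: "open U" and smooth_F: "smooth_on U F" and smooth_E: "smooth_on U E"
    and E_in: "E ` U \<subseteq> S"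
    and inj_F: "\<And>u. u \<in> U \<Longrightarrow> inj (fd F u)"
    and supp: "\<And>x. x \<in> U \<Longrightarrow> \<exists>n. n \<noteq> 0 \<and> (\<forall>w. n \<bullet> fd F x w = 0) \<and> (\<forall>z\<in>S. n \<bullet> z \<le> n \<bullet> E x)"
begin

lemma diff_F: "u \<in> U \<Longrightarrow> F differentiable (at u)"
  using smooth_on_differentiable[OF smooth_F] .

lemma diff_E: "u \<in> U \<Longrightarrow> E differentiable (at u)"
  using smooth_on_differentiable[OF smooth_E] .

lemma normal_nonzero: "u \<in> U \<Longrightarrow> normal_cross F u \<noteq> 0"
  unfolding normal_cross_def using cross3_partial_nonzero diff_F inj_F by blast

lemma normal_partial: "normal_cross F u \<bullet> partial i F u = 0"
  using exhaust_2[of i] by (auto simp: normal_cross_def dot_cross_self)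

text \<open>The linear function with the supporting normal as gradient is maximal on \<open>S\<close> at \<open>E u\<close>, hence critical
  along \<open>E\<close>.\<close>

lemma E_tangent:
  assumes u: "u \<in> U"
  shows "fd E u v \<bullet> normal_cross F u = 0"
proof -
  obtain n where n: "n \<noteq> 0" "\<And>w. n \<bullet> fd F u w = 0" "\<And>z. z \<in> S \<Longrightarrow> n \<bullet> z \<le> n \<bullet> E u"
    using supp u by blast
  obtain s where s: "n = s *\<^sub>R normal_cross F u"
    using parallel_cross3_if_orthogonal[of "partial 1 F u" "partial 2 F u" n] normal_nonzero[OF u] n(2)
    unfolding normal_cross_def partial_def by metis
  have "fd (\<lambda>x. E x \<bullet> n) u v = 0"
  proof (rule max_imp_fd_eq_0[OF open_U u])
    show "(\<lambda>x. E x \<bullet> n) differentiable (at u)" by (intro differentiable_inner diff_E u differentiable_const)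
    show "E y \<bullet> n \<le> E u \<bullet> n" if "y \<in> U" for y
      using n(3)[of "E y"] E_in that by (auto simp: inner_commute)
  qed
  then have "fd E u v \<bullet> n = 0" using fd_inner_const[OF diff_E[OF u], of n v] by simp
  then show ?thesis using s n(1) by simp
qed

lemma fd_tangent_coords:
  assumes u: "u \<in> U" and V: "V u \<in> range (fd F u)"
  shows "fd F u (tangent_coords F V u) = V u"
proof -
  have "V u \<bullet> normal_cross F u = 0"
    using V normal_partial[of u] fd_partial[OF diff_F[OF u]]
    by (auto simp: inner_add_left inner_add_right inner_commute[of _ "normal_cross F u"])
  from in_span_if_orthogonal_cross3[OF normal_nonzero[OF u, unfolded normal_cross_def] this[unfolded normal_cross_def]]
  show ?thesis
    unfolding fd_partial[OF diff_F[OF u]] tangent_coords_def normal_cross_def by (simp add: axis_def)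
qed

lemma normal_ck: "ck_on k U (normal_cross F)"
  unfolding normal_cross_def by (intro ck_on_cross3 open_U smooth_on_partial smooth_F)

lemma tangent_coords_ck:
  assumes "open T" "T \<subseteq> U" "ck_on k T V"
  shows "ck_on k T (tangent_coords F V)"
proof -
  note F = ck_on_subset[OF smooth_on_partial[OF smooth_F] assms(2)]
    and N = ck_on_subset[OF normal_ck assms(2)]
  show ?thesis unfolding tangent_coords_def
    using normal_nonzero assms(2)
    by (intro ck_on_add ck_on_scaleR ck_on_divide ck_on_inner ck_on_cross3 ck_on_const assms F N) auto
qed

lemma shape_trace_ck: "ck_on k U (shape_trace F E)"
  unfolding shape_trace_def using normal_nonzero
  by (intro ck_on_add ck_on_divide ck_on_inner ck_on_cross3 open_U smooth_on_partial smooth_F smooth_E normal_ck) auto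

lemma shape_det_ck: "ck_on k U (shape_det F E)"
  unfolding shape_det_def using normal_nonzero
  by (intro ck_on_divide ck_on_inner ck_on_cross3 open_U smooth_on_partial smooth_F smooth_E normal_ck) auto

lemma shape_disc_ck: "ck_on k U (shape_disc F E)"
  unfolding shape_disc_def power2_eq_square
  by (intro ck_on_diff ck_on_mult ck_on_cmult open_U shape_trace_ck shape_det_ck)

lemma kappa1_continuous: "continuous_on U (kappa1 F E)"
  unfolding kappa1_def using shape_trace_ck[of 0] shape_disc_ck[of 0] by (auto intro!: continuous_intros)

lemma kappa_ck:
  assumes "open T" "T \<subseteq> U" "\<And>x. x \<in> T \<Longrightarrow> shape_disc F E x > 0"
  shows "ck_on k T (kappa1 F E)" "ck_on k T (kappa2 F E)"
  unfolding kappa1_def kappa2_def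
  using ck_on_subset[OF shape_trace_ck assms(2)] ck_on_subset[OF shape_disc_ck assms(2)] assms
  by (auto intro!: ck_on_divide ck_on_add ck_on_diff ck_on_const ck_on_sqrt)

text \<open>The entries \<open>a\<^sub>i\<^sub>j\<close> of \<open>d\<eta>\<close> in the basis of the coordinate vectors of \<open>F\<close>, with the definite form \<open>\<beta>\<close>. The
  last two properties say that \<open>\<beta> a\<close> is the matrix \<open>m \<bullet> D\<^sub>i D\<^sub>j F\<close>; its symmetry makes \<open>d\<eta>\<close> self-adjoint
  for \<open>\<beta>\<close>, and its determinant decides the sign of \<open>det d\<eta>\<close>.\<close>

lemma shape_matrix:
  assumes u: "u \<in> U"
  obtains a11 a12 a21 a22 m \<beta> where
    "partial 1 E u = a11 *\<^sub>R partial 1 F u + a21 *\<^sub>R partial 2 F u"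
    "partial 2 E u = a12 *\<^sub>R partial 1 F u + a22 *\<^sub>R partial 2 F u"
    "shape_trace F E u = a11 + a22" "shape_det F E u = a11 * a22 - a12 * a21"
    "m \<noteq> 0" "\<And>w. m \<bullet> fd F u w = 0"
    "\<And>w. linear (\<lambda>v. \<beta> v w)" "\<And>v w. \<beta> v w = \<beta> w v" "\<And>v. v \<noteq> 0 \<Longrightarrow> 0 < \<beta> v v"
    "\<And>w. a11 * \<beta> (axis 1 1) w + a21 * \<beta> (axis 2 1) w = m \<bullet> fd (\<lambda>x. fd F x w) u (axis 1 1)"
    "\<And>w. a12 * \<beta> (axis 1 1) w + a22 * \<beta> (axis 2 1) w = m \<bullet> fd (\<lambda>x. fd F x w) u (axis 2 1)"
proof -
  note span = in_span_if_orthogonal_cross3[OF normal_nonzero[OF u, unfolded normal_cross_def], folded normal_cross_def]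
  obtain a11 a21 where a1: "partial 1 E u = a11 *\<^sub>R partial 1 F u + a21 *\<^sub>R partial 2 F u"
    using span[of "partial 1 E u"] E_tangent[OF u, of "axis 1 1"] unfolding partial_def by blast
  obtain a12 a22 where a2: "partial 2 E u = a12 *\<^sub>R partial 1 F u + a22 *\<^sub>R partial 2 F u"
    using span[of "partial 2 E u"] E_tangent[OF u, of "axis 2 1"] unfolding partial_def by blast
  have N: "normal_cross F u \<bullet> normal_cross F u \<noteq> 0" using normal_nonzero[OF u] by simp
  have "cross3 (partial 1 E u) (partial 2 F u) + cross3 (partial 1 F u) (partial 2 E u)
      = (a11 + a22) *\<^sub>R normal_cross F u"
    unfolding a1 a2 normal_cross_def
    by (simp add: cross_add_left cross_add_right cross_mult_left cross_mult_right algebra_simps)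
  then have tr: "shape_trace F E u = a11 + a22"
    unfolding shape_trace_def using N by simp
  have "cross3 (partial 1 E u) (partial 2 E u) = (a11 * a22 - a12 * a21) *\<^sub>R normal_cross F u"
    unfolding a1 a2 normal_cross_def
    by (simp add: cross_add_left cross_add_right cross_mult_left cross_mult_right
        cross_skew[of "partial 2 F u" "partial 1 F u"] algebra_simps)
  then have det: "shape_det F E u = a11 * a22 - a12 * a21"
    unfolding shape_det_def using N by simp
  obtain m \<beta> where m: "m \<noteq> 0" "\<And>w. m \<bullet> fd F u w = 0"
    and \<beta>: "\<And>w. linear (\<lambda>v. \<beta> v w)" "\<And>v w. \<beta> v w = \<beta> w v" "\<And>v. v \<noteq> 0 \<Longrightarrow> 0 < \<beta> v v"
    and key: "\<And>v v' w. fd E u v = fd F u v' \<Longrightarrow> \<beta> v' w = m \<bullet> fd (\<lambda>x. fd F x w) u v"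
    using birkhoff_shape_operator_selfadjoint[OF graph curv open_U u smooth_F smooth_E E_in inj_F[OF u] supp]
    by blast
  have "fd E u (axis 1 1) = fd F u (a11 *\<^sub>R axis 1 1 + a21 *\<^sub>R axis 2 1)"
    "fd E u (axis 2 1) = fd F u (a12 *\<^sub>R axis 1 1 + a22 *\<^sub>R axis 2 1)"
    using a1 a2 unfolding partial_def by (simp_all add: linear_add linear_scale fd_linear[OF diff_F[OF u]])
  from key[OF this(1)] key[OF this(2)]
  have "\<And>w. a11 * \<beta> (axis 1 1) w + a21 * \<beta> (axis 2 1) w = m \<bullet> fd (\<lambda>x. fd F x w) u (axis 1 1)"
    "\<And>w. a12 * \<beta> (axis 1 1) w + a22 * \<beta> (axis 2 1) w = m \<bullet> fd (\<lambda>x. fd F x w) u (axis 2 1)"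
    by (simp_all add: linear_add[OF \<beta>(1)] linear_scale[OF \<beta>(1)])
  from that[OF a1 a2 tr det m \<beta> this] show thesis .
qed

lemma second_commute:
  assumes "u \<in> U"
  shows "fd (\<lambda>x. fd F x w) u v = fd (\<lambda>x. fd F x v) u w"
  by (rule second_derivative_symmetric[OF open_U assms smooth_onD[OF smooth_F]])

lemma shape_disc_nonneg:
  assumes u: "u \<in> U"
  shows "0 \<le> shape_disc F E u"
    and "shape_disc F E u = 0 \<Longrightarrow> fd E u v = kappa1 F E u *\<^sub>R fd F u v"
proof -
  obtain a11 a12 a21 a22 m \<beta> where a: "partial 1 E u = a11 *\<^sub>R partial 1 F u + a21 *\<^sub>R partial 2 F u"
    "partial 2 E u = a12 *\<^sub>R partial 1 F u + a22 *\<^sub>R partial 2 F u"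
    and td: "shape_trace F E u = a11 + a22" "shape_det F E u = a11 * a22 - a12 * a21"
    and m: "m \<noteq> 0" "\<And>w. m \<bullet> fd F u w = 0"
    and \<beta>: "\<And>w. linear (\<lambda>v. \<beta> v w)" "\<And>v w. \<beta> v w = \<beta> w v" "\<And>v. v \<noteq> 0 \<Longrightarrow> 0 < \<beta> v v"
    and H: "\<And>w. a11 * \<beta> (axis 1 1) w + a21 * \<beta> (axis 2 1) w = m \<bullet> fd (\<lambda>x. fd F x w) u (axis 1 1)"
    "\<And>w. a12 * \<beta> (axis 1 1) w + a22 * \<beta> (axis 2 1) w = m \<bullet> fd (\<lambda>x. fd F x w) u (axis 2 1)"
    by (rule shape_matrix[OF u], rule that)
  \<comment> \<open>The symmetry of the second derivatives of \<open>F\<close>, expressed in the matrix entries.\<close>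
  have eq: "\<beta> (axis 1 1) (axis 1 1) * a12 - \<beta> (axis 2 1) (axis 2 1) * a21
      = \<beta> (axis 1 1) (axis 2 1) * (a11 - a22)"
    using H(1)[of "axis 2 1"] H(2)[of "axis 1 1"] second_commute[OF u, of "axis 1 1" "axis 2 1"]
      \<beta>(2)[of "axis 2 1" "axis 1 1"]
    by (simp add: algebra_simps)
  have disc: "shape_disc F E u = (a11 - a22)\<^sup>2 + 4 * a12 * a21"
    unfolding shape_disc_def td by (simp add: power2_eq_square algebra_simps)
  note * = selfadjoint_discriminant[OF positive_form_det[OF \<beta>] eq]
  show "0 \<le> shape_disc F E u" unfolding disc by (rule *(1))
  assume 0: "shape_disc F E u = 0"
  then have "a12 = 0 \<and> a21 = 0 \<and> a11 = a22" using *(2) unfolding disc by simp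
  then show "fd E u v = kappa1 F E u *\<^sub>R fd F u v"
    unfolding fd_partial[OF diff_E[OF u]] fd_partial[OF diff_F[OF u]] kappa1_def 0 a td
    by (simp add: algebra_simps)
qed

lemma kappa_roots:
  assumes "u \<in> U"
  shows "\<mu>\<^sup>2 - shape_trace F E u * \<mu> + shape_det F E u = (\<mu> - kappa1 F E u) * (\<mu> - kappa2 F E u)"
    and "kappa1 F E u * kappa2 F E u = shape_det F E u"
    and "kappa2 F E u \<le> kappa1 F E u"
    and "shape_disc F E u = (kappa1 F E u - kappa2 F E u)\<^sup>2"
proof -
  have d: "sqrt (shape_disc F E u) * sqrt (shape_disc F E u) = (shape_trace F E u)\<^sup>2 - 4 * shape_det F E u"
    using shape_disc_nonneg(1)[OF assms] by (simp add: shape_disc_def)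
  show p: "kappa1 F E u * kappa2 F E u = shape_det F E u"
    unfolding kappa1_def kappa2_def using d by (simp add: power2_eq_square algebra_simps)
  have s: "kappa1 F E u + kappa2 F E u = shape_trace F E u" unfolding kappa1_def kappa2_def by (simp add: field_simps)
  show "\<mu>\<^sup>2 - shape_trace F E u * \<mu> + shape_det F E u = (\<mu> - kappa1 F E u) * (\<mu> - kappa2 F E u)"
    unfolding p[symmetric] s[symmetric] by (simp add: power2_eq_square algebra_simps)
  show "kappa2 F E u \<le> kappa1 F E u" unfolding kappa1_def kappa2_def
    using shape_disc_nonneg(1)[OF assms] by simp
  have "kappa1 F E u - kappa2 F E u = sqrt (shape_disc F E u)"
    unfolding kappa1_def kappa2_def by (simp add: field_simps)
  then show "shape_disc F E u = (kappa1 F E u - kappa2 F E u)\<^sup>2"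
    using shape_disc_nonneg(1)[OF assms] by simp
qed

lemma eigenvalues_eq:
  assumes u: "u \<in> U"
  shows "{\<mu>. \<exists>v. v \<noteq> 0 \<and> fd E u v = \<mu> *\<^sub>R fd F u v} = {kappa1 F E u, kappa2 F E u}"
proof -
  obtain a11 a12 a21 a22 m \<beta> where a: "partial 1 E u = a11 *\<^sub>R partial 1 F u + a21 *\<^sub>R partial 2 F u"
    "partial 2 E u = a12 *\<^sub>R partial 1 F u + a22 *\<^sub>R partial 2 F u"
    and td: "shape_trace F E u = a11 + a22" "shape_det F E u = a11 * a22 - a12 * a21"
    and m: "m \<noteq> 0" "\<And>w. m \<bullet> fd F u w = 0"
    and \<beta>: "\<And>w. linear (\<lambda>v. \<beta> v w)" "\<And>v w. \<beta> v w = \<beta> w v" "\<And>v. v \<noteq> 0 \<Longrightarrow> 0 < \<beta> v v"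
    and H: "\<And>w. a11 * \<beta> (axis 1 1) w + a21 * \<beta> (axis 2 1) w = m \<bullet> fd (\<lambda>x. fd F x w) u (axis 1 1)"
    "\<And>w. a12 * \<beta> (axis 1 1) w + a22 * \<beta> (axis 2 1) w = m \<bullet> fd (\<lambda>x. fd F x w) u (axis 2 1)"
    by (rule shape_matrix[OF u], rule that)
  have lin: "linear (fd F u)" using fd_linear[OF diff_F[OF u]] .
  have eig: "fd E u v = \<mu> *\<^sub>R fd F u v \<longleftrightarrow>
      (a11 - \<mu>) * v$1 + a12 * v$2 = 0 \<and> a21 * v$1 + (a22 - \<mu>) * v$2 = 0" for v \<mu>
  proof -
    define w :: "real^2" where "w = ((a11 - \<mu>) * v$1 + a12 * v$2) *\<^sub>R axis 1 1 + (a21 * v$1 + (a22 - \<mu>) * v$2) *\<^sub>R axis 2 1"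
    have w: "w $ 1 = (a11 - \<mu>) * v$1 + a12 * v$2" "w $ 2 = a21 * v$1 + (a22 - \<mu>) * v$2"
      by (simp_all add: w_def axis_def)
    have "fd E u v - \<mu> *\<^sub>R fd F u v = fd F u w"
      unfolding fd_partial[OF diff_E[OF u]] fd_partial[OF diff_F[OF u]] a w by (simp add: algebra_simps)
    then have "fd E u v = \<mu> *\<^sub>R fd F u v \<longleftrightarrow> fd F u w = fd F u 0" using linear_0[OF lin] by auto
    also have "\<dots> \<longleftrightarrow> w = 0" using inj_F[OF u] by (auto dest: injD)
    also have "\<dots> \<longleftrightarrow> w $ 1 = 0 \<and> w $ 2 = 0" by (simp add: vec_eq_iff forall_2)
    finally show ?thesis unfolding w .
  qed
  have "(\<exists>v. v \<noteq> 0 \<and> fd E u v = \<mu> *\<^sub>R fd F u v) \<longleftrightarrow> \<mu>\<^sup>2 - (a11 + a22) * \<mu> + (a11 * a22 - a12 * a21) = 0" for \<mu>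
  proof
    assume "\<exists>v. v \<noteq> 0 \<and> fd E u v = \<mu> *\<^sub>R fd F u v"
    then obtain v where "v \<noteq> 0" "fd E u v = \<mu> *\<^sub>R fd F u v" by blast
    then have v: "v \<noteq> 0" "(a11 - \<mu>) * v$1 + a12 * v$2 = 0" "a21 * v$1 + (a22 - \<mu>) * v$2 = 0"
      using eig by auto
    have "((a11 - \<mu>) * (a22 - \<mu>) - a12 * a21) * v$1 = 0" "((a11 - \<mu>) * (a22 - \<mu>) - a12 * a21) * v$2 = 0"
    proof -
      have "((a11 - \<mu>) * (a22 - \<mu>) - a12 * a21) * v$1 =
        (a22 - \<mu>) * ((a11 - \<mu>) * v$1 + a12 * v$2) - a12 * (a21 * v$1 + (a22 - \<mu>) * v$2)"
        by (simp add: algebra_simps)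
      then show "((a11 - \<mu>) * (a22 - \<mu>) - a12 * a21) * v$1 = 0" using v by simp
      have "((a11 - \<mu>) * (a22 - \<mu>) - a12 * a21) * v$2 =
        (a11 - \<mu>) * (a21 * v$1 + (a22 - \<mu>) * v$2) - a21 * ((a11 - \<mu>) * v$1 + a12 * v$2)"
        by (simp add: algebra_simps)
      then show "((a11 - \<mu>) * (a22 - \<mu>) - a12 * a21) * v$2 = 0" using v by simp
    qed
    moreover have "v$1 \<noteq> 0 \<or> v$2 \<noteq> 0" using v(1) by (auto simp: vec_eq_iff forall_2)
    ultimately have "(a11 - \<mu>) * (a22 - \<mu>) - a12 * a21 = 0" by auto
    then show "\<mu>\<^sup>2 - (a11 + a22) * \<mu> + (a11 * a22 - a12 * a21) = 0"
      by (simp add: power2_eq_square algebra_simps)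
  next
    assume "\<mu>\<^sup>2 - (a11 + a22) * \<mu> + (a11 * a22 - a12 * a21) = 0"
    then have 0: "(a11 - \<mu>) * (a22 - \<mu>) = a12 * a21" by (simp add: power2_eq_square algebra_simps)
    have "\<exists>x y. (x \<noteq> 0 \<or> y \<noteq> 0) \<and> (a11 - \<mu>) * x + a12 * y = 0 \<and> a21 * x + (a22 - \<mu>) * y = 0"
    proof (cases "a12 = 0 \<and> a11 = \<mu>")
      case True
      show ?thesis
      proof (cases "a21 = 0 \<and> a22 = \<mu>")
        case True
        then show ?thesis using \<open>a12 = 0 \<and> a11 = \<mu>\<close> by (intro exI[of _ 1] exI[of _ 0]) auto
      next
        case False
        then show ?thesis using True by (intro exI[of _ "a22 - \<mu>"] exI[of _ "- a21"]) auto
      qed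
    next
      case False
      then show ?thesis using 0 by (intro exI[of _ "- a12"] exI[of _ "a11 - \<mu>"]) (auto simp: mult.commute)
    qed
    then obtain x y where xy: "x \<noteq> 0 \<or> y \<noteq> 0" "(a11 - \<mu>) * x + a12 * y = 0" "a21 * x + (a22 - \<mu>) * y = 0" by blast
    define v :: "real^2" where "v = x *\<^sub>R axis 1 1 + y *\<^sub>R axis 2 1"
    have v: "v$1 = x" "v$2 = y" by (simp_all add: v_def axis_def)
    then have "v \<noteq> 0" using xy(1) by auto
    moreover have "fd E u v = \<mu> *\<^sub>R fd F u v" using xy v eig[of v \<mu>] by simp
    ultimately show "\<exists>v. v \<noteq> 0 \<and> fd E u v = \<mu> *\<^sub>R fd F u v" by blast
  qed
  then show ?thesis unfolding td[symmetric] kappa_roots(1)[OF u] by auto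
qed

text \<open>At the farthest point \<open>F u\<close> is itself a normal vector, and the second order condition reads
  \<open>F \<bullet> D\<^sub>v D\<^sub>v F \<le> - norm (D\<^sub>v F)\<^sup>2 < 0\<close>. So the matrix \<open>m \<bullet> D\<^sub>i D\<^sub>j F\<close> is definite; it is the product of the
  definite matrix of \<open>\<beta>\<close> with the matrix of \<open>d\<eta>\<close>, whose determinant is therefore positive.\<close>

lemma shape_det_pos_at_farthest_point:
  assumes u: "u \<in> U" and max: "\<And>x. x \<in> U \<Longrightarrow> norm (F x) \<le> norm (F u)"
  shows "shape_det F E u > 0"
proof -
  obtain a11 a12 a21 a22 m \<beta> where a: "partial 1 E u = a11 *\<^sub>R partial 1 F u + a21 *\<^sub>R partial 2 F u"
    "partial 2 E u = a12 *\<^sub>R partial 1 F u + a22 *\<^sub>R partial 2 F u"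
    and td: "shape_trace F E u = a11 + a22" "shape_det F E u = a11 * a22 - a12 * a21"
    and m: "m \<noteq> 0" "\<And>w. m \<bullet> fd F u w = 0"
    and \<beta>: "\<And>w. linear (\<lambda>v. \<beta> v w)" "\<And>v w. \<beta> v w = \<beta> w v" "\<And>v. v \<noteq> 0 \<Longrightarrow> 0 < \<beta> v v"
    and H: "\<And>w. a11 * \<beta> (axis 1 1) w + a21 * \<beta> (axis 2 1) w = m \<bullet> fd (\<lambda>x. fd F x w) u (axis 1 1)"
    "\<And>w. a12 * \<beta> (axis 1 1) w + a22 * \<beta> (axis 2 1) w = m \<bullet> fd (\<lambda>x. fd F x w) u (axis 2 1)"
    by (rule shape_matrix[OF u], rule that)
  have dFv: "(\<lambda>x. fd F x v) differentiable (at x)" if "x \<in> U" for x v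
    using smooth_on_differentiable[OF smooth_on_fd[OF smooth_F] that] .
  define g where "g x = F x \<bullet> F x" for x
  have Dg: "(g has_derivative (\<lambda>v. 2 * (F x \<bullet> fd F x v))) (at x)" if "x \<in> U" for x
    using has_derivative_inner[OF fd_works[OF diff_F[OF that]] fd_works[OF diff_F[OF that]]]
    unfolding g_def by (simp add: inner_commute)
  have gle: "g x \<le> g u" if "x \<in> U" for x
    using max[OF that] unfolding g_def by (simp add: power2_norm_eq_inner[symmetric] power_mono)
  have dg: "g differentiable (at x)" if "x \<in> U" for x using Dg[OF that] differentiableI by blast
  have FF: "F u \<bullet> fd F u v = 0" for v
    using max_imp_fd_eq_0[OF open_U u dg[OF u] gle, of v] fd_apply_eqI[OF Dg[OF u], of v] by simp
  have neg: "F u \<bullet> fd (\<lambda>x. fd F x v) u v < 0" if "v \<noteq> 0" for v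
  proof -
    have "((\<lambda>x. F x \<bullet> fd F x v) has_derivative (\<lambda>h. F u \<bullet> fd (\<lambda>x. fd F x v) u h + fd F u h \<bullet> fd F u v)) (at u)"
      by (rule has_derivative_inner[OF fd_works[OF diff_F[OF u]] fd_works[OF dFv[OF u]]])
    then have D2: "((\<lambda>x. 2 * (F x \<bullet> fd F x v)) has_derivative
        (\<lambda>h. 2 * (F u \<bullet> fd (\<lambda>x. fd F x v) u h + fd F u h \<bullet> fd F u v))) (at u)"
      by (rule has_derivative_mult_right)
    have D2': "((\<lambda>x. fd g x v) has_derivative
        (\<lambda>h. 2 * (F u \<bullet> fd (\<lambda>x. fd F x v) u h + fd F u h \<bullet> fd F u v))) (at u)"
      by (rule has_derivative_transform_within_open[OF D2 open_U u]) (simp add: fd_apply_eqI[OF Dg])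
    have "fd (\<lambda>x. fd g x v) u v \<le> 0"
      by (rule max_imp_second_derivative_le_0[OF open_U u dg _ gle]) (use D2' in \<open>auto intro: differentiableI\<close>)
    then have "F u \<bullet> fd (\<lambda>x. fd F x v) u v + fd F u v \<bullet> fd F u v \<le> 0"
      unfolding fd_apply_eqI[OF D2'] by simp
    moreover have "fd F u v \<noteq> 0"
      using that inj_F[OF u] linear_0[OF fd_linear[OF diff_F[OF u]]] by (metis injD)
    then have "fd F u v \<bullet> fd F u v > 0" by simp
    ultimately show ?thesis by linarith
  qed
  obtain s where s: "F u = s *\<^sub>R normal_cross F u"
    using parallel_cross3_if_orthogonal[of "partial 1 F u" "partial 2 F u" "F u"] normal_nonzero[OF u] FF
    unfolding normal_cross_def partial_def by metis
  obtain s' where s': "m = s' *\<^sub>R normal_cross F u"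
    using parallel_cross3_if_orthogonal[of "partial 1 F u" "partial 2 F u" m] normal_nonzero[OF u] m(2)
    unfolding normal_cross_def partial_def by metis
  have "s' \<noteq> 0" using s' m(1) by auto
  define t where "t = s / s'"
  have t: "F u = t *\<^sub>R m" unfolding t_def s s' using \<open>s' \<noteq> 0\<close> by simp
  define Q where "Q v w = - (F u \<bullet> fd (\<lambda>x. fd F x w) u v)" for v w
  have "(Q (axis 1 1) (axis 2 1))\<^sup>2 < Q (axis 1 1) (axis 1 1) * Q (axis 2 1) (axis 2 1)"
  proof (rule positive_form_det)
    show "linear (\<lambda>v. Q v w)" for w
      unfolding Q_def using fd_linear[OF dFv[OF u, of w]]
      by (auto intro!: linearI simp: linear_add linear_scale inner_add_right)
    show "Q v w = Q w v" for v w unfolding Q_def using second_commute[OF u, of w v] by simp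
    show "0 < Q v v" if "v \<noteq> 0" for v unfolding Q_def using neg[OF that] by simp
  qed
  moreover have "Q (axis 1 1) (axis 2 1) = Q (axis 2 1) (axis 1 1)"
    unfolding Q_def using second_commute[OF u, of "axis 1 1" "axis 2 1"] by simp
  ultimately have "0 < Q (axis 1 1) (axis 1 1) * Q (axis 2 1) (axis 2 1) -
      Q (axis 1 1) (axis 2 1) * Q (axis 2 1) (axis 1 1)" by (simp add: power2_eq_square)
  moreover have Q1: "Q (axis 1 1) w = - t * (a11 * \<beta> (axis 1 1) w + a21 * \<beta> (axis 2 1) w)"
    and Q2: "Q (axis 2 1) w = - t * (a12 * \<beta> (axis 1 1) w + a22 * \<beta> (axis 2 1) w)" for w
    unfolding Q_def t H by simp_all
  have "Q (axis 1 1) (axis 1 1) * Q (axis 2 1) (axis 2 1) - Q (axis 1 1) (axis 2 1) * Q (axis 2 1) (axis 1 1)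
     = t\<^sup>2 * ((\<beta> (axis 1 1) (axis 1 1) * \<beta> (axis 2 1) (axis 2 1) - (\<beta> (axis 1 1) (axis 2 1))\<^sup>2) *
      (a11 * a22 - a12 * a21))"
    unfolding Q1 Q2 \<beta>(2)[of "axis 2 1" "axis 1 1"] by (simp add: power2_eq_square algebra_simps)
  ultimately have "0 < (\<beta> (axis 1 1) (axis 1 1) * \<beta> (axis 2 1) (axis 2 1) - (\<beta> (axis 1 1) (axis 2 1))\<^sup>2) *
      (a11 * a22 - a12 * a21)" by (simp add: zero_less_mult_iff)
  moreover have "0 < \<beta> (axis 1 1) (axis 1 1) * \<beta> (axis 2 1) (axis 2 1) - (\<beta> (axis 1 1) (axis 2 1))\<^sup>2"
    using positive_form_det[OF \<beta>] by simp
  ultimately show ?thesis unfolding td by (simp add: zero_less_mult_iff)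
qed

text \<open>The product rule in \<open>D\<^bsub>V\<^sub>1\<^esub>(\<lambda>\<^sub>2 V\<^sub>2) = D\<^bsub>V\<^sub>2\<^esub>(\<lambda>\<^sub>1 V\<^sub>1)\<close>, with \<open>D\<^bsub>V\<^sub>1\<^esub>V\<^sub>2 = D\<^bsub>V\<^sub>2\<^esub>V\<^sub>1\<close>.\<close>

lemma codazzi:
  assumes x: "x \<in> U" "shape_disc F E x > 0"
    and V: "V1 differentiable (at x)" "V2 differentiable (at x)"
    and br1: "fd V2 x v1 = fd V1 x v2"
    and br2: "fd (\<lambda>y. kappa2 F E y *\<^sub>R V2 y) x v1 = fd (\<lambda>y. kappa1 F E y *\<^sub>R V1 y) x v2"
  shows "(kappa2 F E x - kappa1 F E x) *\<^sub>R fd V2 x v1 =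
    fd (kappa1 F E) x v2 *\<^sub>R V1 x - fd (kappa2 F E) x v1 *\<^sub>R V2 x"
proof -
  define T where "T = {y \<in> U. shape_disc F E y > 0}"
  have "T = U \<inter> shape_disc F E -` {0<..}" by (auto simp: T_def)
  then have T: "open T" "T \<subseteq> U" "x \<in> T"
    using continuous_open_preimage[OF _ open_U, of "shape_disc F E" "{0<..}"] shape_disc_ck[of 0] x
    by auto
  have k: "kappa1 F E differentiable (at x)" "kappa2 F E differentiable (at x)"
    using kappa_ck[OF T(1,2), of "Suc 0"] T(3) by (auto simp: T_def)
  have "fd (\<lambda>y. kappa2 F E y *\<^sub>R V2 y) x v1 = kappa2 F E x *\<^sub>R fd V2 x v1 + fd (kappa2 F E) x v1 *\<^sub>R V2 x"
    by (rule fd_apply_eqI) (rule has_derivative_scaleR[OF fd_works[OF k(2)] fd_works[OF V(2)]])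
  moreover have "fd (\<lambda>y. kappa1 F E y *\<^sub>R V1 y) x v2 = kappa1 F E x *\<^sub>R fd V1 x v2 + fd (kappa1 F E) x v2 *\<^sub>R V1 x"
    by (rule fd_apply_eqI) (rule has_derivative_scaleR[OF fd_works[OF k(1)] fd_works[OF V(1)]])
  ultimately show ?thesis using br1 br2 by (simp add: algebra_simps)
qed

end

text \<open>Where \<open>d\<kappa>\<close> vanishes, differentiating \<open>d\<kappa>(v)\<close> does not see the variation of the field \<open>v\<close>. This makes
  the second derivative of \<open>\<kappa>\<close> along a field equal to the one along the straight line in direction \<open>v u\<close>.\<close>

lemma fd_along_field_at_critical_point:
  fixes \<kappa> :: "real^2 \<Rightarrow> real" and v :: "real^2 \<Rightarrow> real^2"
  assumes "open T" "u \<in> T" "ck_on 2 T \<kappa>" "v differentiable (at u)" "\<And>w. fd \<kappa> u w = 0"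
  shows "((\<lambda>x. fd \<kappa> x (v x)) has_derivative (\<lambda>w. fd (\<lambda>x. fd \<kappa> x (v u)) u w)) (at u)"
proof -
  have d1: "\<kappa> differentiable (at x)" and d2: "(\<lambda>x. fd \<kappa> x w) differentiable (at x)" if "x \<in> T" for x w
    using assms(3) that by (auto simp: numeral_2_eq_2)
  have exp: "fd \<kappa> x w = w $ 1 * fd \<kappa> x (axis 1 1) + w $ 2 * fd \<kappa> x (axis 2 1)" if "x \<in> T" for x w
    using linear_vec2[OF fd_linear[OF d1[OF that]], of w] by simp
  have dv: "((\<lambda>x. v x $ i) has_derivative (\<lambda>w. fd v u w $ i)) (at u)" for i
    by (rule bounded_linear.has_derivative[OF bounded_linear_vec_nth fd_works[OF assms(4)]])
  let ?R = "\<lambda>w. v u $ 1 * fd (\<lambda>x. fd \<kappa> x (axis 1 1)) u w + v u $ 2 * fd (\<lambda>x. fd \<kappa> x (axis 2 1)) u w"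
  have "((\<lambda>x. v x $ 1 * fd \<kappa> x (axis 1 1) + v x $ 2 * fd \<kappa> x (axis 2 1)) has_derivative
     (\<lambda>w. (v u $ 1 * fd (\<lambda>x. fd \<kappa> x (axis 1 1)) u w + fd v u w $ 1 * fd \<kappa> u (axis 1 1)) +
      (v u $ 2 * fd (\<lambda>x. fd \<kappa> x (axis 2 1)) u w + fd v u w $ 2 * fd \<kappa> u (axis 2 1)))) (at u)"
    by (intro has_derivative_add has_derivative_mult dv fd_works d2 assms)
  then have "((\<lambda>x. v x $ 1 * fd \<kappa> x (axis 1 1) + v x $ 2 * fd \<kappa> x (axis 2 1)) has_derivative ?R) (at u)"
    using assms(5) by simp
  then have 1: "((\<lambda>x. fd \<kappa> x (v x)) has_derivative ?R) (at u)"
    by (rule has_derivative_transform_within_open[OF _ assms(1,2)]) (rule exp[symmetric])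
  have "((\<lambda>x. v u $ 1 * fd \<kappa> x (axis 1 1) + v u $ 2 * fd \<kappa> x (axis 2 1)) has_derivative ?R) (at u)"
    by (intro has_derivative_add has_derivative_mult_right fd_works d2 assms)
  then have 2: "((\<lambda>x. fd \<kappa> x (v u)) has_derivative ?R) (at u)"
    by (rule has_derivative_transform_within_open[OF _ assms(1,2)]) (rule exp[symmetric])
  have "fd (\<lambda>x. fd \<kappa> x (v u)) u = ?R" by (rule fd_eqI[OF 2])
  then show ?thesis using 1 by simp
qed

section \<open>Charts\<close>

lemma homeomorphism_inj_on: "homeomorphism S T f g \<Longrightarrow> inj_on f S"
  unfolding homeomorphism_def by (metis inj_on_inverseI)

locale immersed_surface =
  fixes M :: "'m::t2_space set" and A :: "'m chart set" and f :: "'m \<Rightarrow> real^3"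
  assumes surface: "smooth_surface M A" and immersed: "immersion M A f"
begin

abbreviation coord_dom :: "'m chart \<Rightarrow> (real^2) set" where
  "coord_dom c \<equiv> snd c ` fst c"

lemma chart_openin: "c \<in> A \<Longrightarrow> openin (top_of_set M) (fst c)"
  and chart_open: "c \<in> A \<Longrightarrow> open (coord_dom c)"
  and chart_homeo: "c \<in> A \<Longrightarrow> homeomorphism (fst c) (coord_dom c) (snd c) (inv_into (fst c) (snd c))"
  using surface unfolding smooth_surface_def by blast+

lemma chart_subset: "c \<in> A \<Longrightarrow> fst c \<subseteq> M"
  using chart_openin openin_imp_subset by blast

lemma chart_exists:
  assumes "p \<in> M"
  obtains c where "c \<in> A" "p \<in> fst c"
  using surface assms unfolding smooth_surface_def by blast

lemma chart_at: "p \<in> M \<Longrightarrow> chart_at A p \<in> A" "p \<in> M \<Longrightarrow> p \<in> fst (chart_at A p)"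
  unfolding chart_at_def using someI_ex[of "\<lambda>c. c \<in> A \<and> p \<in> fst c"] chart_exists by metis+

lemma chart_inv: "c \<in> A \<Longrightarrow> p \<in> fst c \<Longrightarrow> inv_into (fst c) (snd c) (snd c p) = p"
  using homeomorphism_inj_on[OF chart_homeo] inv_into_f_f by metis

lemma coord_rep_chart: "c \<in> A \<Longrightarrow> p \<in> fst c \<Longrightarrow> coord_rep c g (snd c p) = g p"
  by (simp add: coord_rep_def chart_inv)

lemma chart_image_open:
  assumes "c \<in> A" "openin (top_of_set M) W"
  shows "open (snd c ` (fst c \<inter> W))"
proof -
  have "openin (top_of_set M) (fst c \<inter> W)" using chart_openin assms by blast
  then have "openin (top_of_set (fst c)) (fst c \<inter> W)"
    using chart_subset[OF assms(1)] by (metis inf_le1 openin_subset_trans)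
  then have "openin (top_of_set (coord_dom c)) (snd c ` (fst c \<inter> W))"
    using homeomorphism_imp_open_map[OF chart_homeo[OF assms(1)]] by blast
  then show ?thesis using chart_open[OF assms(1)] openin_open_trans by blast
qed

lemma smooth_coord_rep:
  assumes "c \<in> A" "smooth_map_on A M g"
  shows "smooth_on (coord_dom c) (coord_rep c g)"
  using assms chart_subset[OF assms(1)] unfolding smooth_map_on_def by (metis inf.absorb1)

lemma smooth_f: "smooth_map_on A M f"
  using immersed unfolding immersion_def by blast

lemma diff_coord_f: "c \<in> A \<Longrightarrow> p \<in> fst c \<Longrightarrow> coord_rep c f differentiable (at (snd c p))"
  using smooth_on_differentiable[OF smooth_coord_rep[OF _ smooth_f]] by blast

lemma inj_coord_differential: "c \<in> A \<Longrightarrow> p \<in> fst c \<Longrightarrow> inj (coord_differential c f p)"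
  using immersed unfolding immersion_def by blast

text \<open>The chain rule for the transition map. Differentiability is transported as well, because the functions
  of interest include some, such as derivatives along vector fields, that are only known to be
  differentiable through their expression in one chart.\<close>

lemma change_of_chart:
  assumes c: "c \<in> A" "p \<in> fst c" and d: "d \<in> A" "p \<in> fst d"
    and g: "coord_rep d g differentiable (at (snd d p))"
  shows "coord_rep c g differentiable (at (snd c p))"
    and "coord_differential c g p v =
      coord_differential d g p (fd (coord_rep c (snd d)) (snd c p) v)"
proof -
  let ?\<tau> = "coord_rep c (snd d)" and ?T = "snd c ` (fst c \<inter> fst d)"
  have T: "open ?T" "snd c p \<in> ?T" using chart_image_open[OF c(1) chart_openin[OF d(1)]] c d by auto
  have "smooth_on ?T ?\<tau>" using surface c d unfolding smooth_surface_def by blast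
  then have \<tau>: "?\<tau> differentiable (at (snd c p))" using smooth_on_differentiable T by blast
  have \<tau>p: "?\<tau> (snd c p) = snd d p" using coord_rep_chart c by blast
  have "(coord_rep d g has_derivative coord_differential d g p) (at (?\<tau> (snd c p)))"
    unfolding coord_differential_def \<tau>p by (rule fd_works[OF g])
  from has_derivative_compose[OF fd_works[OF \<tau>] this]
  have "(coord_rep c g has_derivative (\<lambda>v. coord_differential d g p (fd ?\<tau> (snd c p) v))) (at (snd c p))"
  proof (rule has_derivative_transform_within_open[OF _ T])
    fix x assume "x \<in> ?T"
    then obtain q where "q \<in> fst c" "q \<in> fst d" "x = snd c q" by blast
    then show "coord_rep d g (?\<tau> x) = coord_rep c g x" using c d by (simp add: coord_rep_chart)
  qed
  then show "coord_rep c g differentiable (at (snd c p))"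
    and "coord_differential c g p v = coord_differential d g p (fd ?\<tau> (snd c p) v)"
    unfolding coord_differential_def by (auto intro: differentiableI fd_apply_eqI)
qed

lemma tangent_plane_chart:
  assumes "c \<in> A" "p \<in> fst c"
  shows "tangent_plane A f p = range (coord_differential c f p)"
proof -
  have sub: "range (coord_differential c f p) \<subseteq> range (coord_differential d f p)"
    if "c \<in> A" "p \<in> fst c" "d \<in> A" "p \<in> fst d" for c d
    using change_of_chart(2)[OF that diff_coord_f[OF that(3,4)]] by auto
  have "p \<in> M" using assms chart_subset by blast
  note d = chart_at[OF this]
  show ?thesis unfolding tangent_plane_def using sub[OF assms d] sub[OF d assms] by blast
qed

text \<open>This removes the arbitrary choice of \<open>chart_at\<close>: derivatives at all points of a chart domain may be
  computed in that one chart, which is what second derivatives require.\<close>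

lemma deriv_along_chart:
  assumes c: "c \<in> A" "p \<in> fst c" and g: "coord_rep c g differentiable (at (snd c p))"
  shows "deriv_along A f g p (coord_differential c f p a) = coord_differential c g p a"
proof -
  have "p \<in> M" using c chart_subset by blast
  note d = chart_at[OF this]
  let ?a = "fd (coord_rep c (snd (chart_at A p))) (snd c p) a"
  have eq: "coord_differential c f p a = coord_differential (chart_at A p) f p ?a"
    by (rule change_of_chart(2)[OF c d diff_coord_f[OF d]])
  have "(THE b. coord_differential (chart_at A p) f p b = coord_differential c f p a) = ?a"
    unfolding eq using inj_coord_differential[OF d] by (intro the_equality) (auto dest: injD)
  then show ?thesis
    unfolding deriv_along_def
    by (simp add: change_of_chart(2)[OF c d change_of_chart(1)[OF d c g]])
qed

lemma continuous_on_chartI: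
  assumes "\<And>c. c \<in> A \<Longrightarrow> continuous_on (coord_dom c) (coord_rep c g)"
  shows "continuous_on M g"
  unfolding continuous_on_eq_continuous_within
proof
  fix p assume "p \<in> M"
  then obtain c where c: "c \<in> A" "p \<in> fst c" using chart_exists by blast
  have "continuous_on (fst c) (snd c)" using chart_homeo[OF c(1)] unfolding homeomorphism_def by blast
  then have "continuous_on (fst c) (\<lambda>q. coord_rep c g (snd c q))"
    by (rule continuous_on_compose2[OF assms[OF c(1)]]) auto
  then have "continuous_on (fst c) g"
    by (rule continuous_on_eq) (simp add: coord_rep_chart c)
  then have cont: "continuous (at p within fst c) g" using c continuous_on_eq_continuous_within by blast
  obtain T where "open T" "fst c = M \<inter> T" using chart_openin[OF c(1)] by (auto simp: openin_open)
  then have "at p within M = at p within fst c" using c by (intro at_within_nhd[of p T]) auto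
  then show "continuous (at p within M) g" using cont by simp
qed

lemma continuous_on_smooth_map: "smooth_map_on A M g \<Longrightarrow> continuous_on M g"
  by (rule continuous_on_chartI) (rule smooth_on_continuous[OF smooth_coord_rep])

lemma locally_constant_chart:
  assumes p: "c \<in> A" "p \<in> fst c"
    and 0: "\<And>x. x \<in> coord_dom c \<Longrightarrow> (coord_rep c g has_derivative (\<lambda>h. 0)) (at x)"
  shows "\<exists>T. openin (top_of_set M) T \<and> p \<in> T \<and> (\<forall>q\<in>T. g q = g p)"
proof -
  have "snd c p \<in> coord_dom c" using p by blast
  then obtain e where e: "e > 0" "ball (snd c p) e \<subseteq> coord_dom c"
    using chart_open[OF p(1)] openE by blast
  define T where "T = fst c \<inter> snd c -` ball (snd c p) e"
  have cont: "continuous_on (fst c) (snd c)" using chart_homeo[OF p(1)] unfolding homeomorphism_def by blast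
  have "openin (top_of_set (fst c)) T"
    unfolding T_def by (rule continuous_openin_preimage_gen[OF cont open_ball])
  then have "openin (top_of_set M) T" using chart_openin[OF p(1)] openin_trans by blast
  moreover have "p \<in> T" using p e by (simp add: T_def)
  moreover have "g q = g p" if "q \<in> T" for q
  proof -
    have "coord_rep c g (snd c q) = coord_rep c g (snd c p)"
    proof -
      have der: "(coord_rep c g has_derivative (\<lambda>h. 0)) (at x within ball (snd c p) e)"
        if "x \<in> ball (snd c p) e" for x
        by (rule has_derivative_at_withinI[OF 0[OF subsetD[OF e(2) that]]])
      have "snd c q \<in> ball (snd c p) e" "snd c p \<in> ball (snd c p) e" using that e(1) by (simp_all add: T_def)
      with has_derivative_zero_constant[OF convex_ball der] show ?thesis by metis
    qed
    then show ?thesis using that p by (simp add: T_def coord_rep_chart)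
  qed
  ultimately show ?thesis by blast
qed

end

section \<open>Principal curvatures of an immersed surface\<close>

locale birkhoff_surface = immersed_surface M A f
  for M :: "'m::t2_space set" and A :: "'m chart set" and f :: "'m \<Rightarrow> real^3" +
  fixes nrm :: "real^3 \<Rightarrow> real" and \<eta> :: "'m \<Rightarrow> real^3"
  assumes admissible: "admissible_norm nrm" and normal_field: "birkhoff_normal_field nrm M A f \<eta>"
begin

lemma smooth_eta: "smooth_map_on A M \<eta>" and nrm_eta: "p \<in> M \<Longrightarrow> nrm (\<eta> p) = 1"
  using normal_field unfolding birkhoff_normal_field_def unit_sphere_def by auto

text \<open>The plane through \<open>\<eta> p\<close> contains \<open>\<eta> p\<close> itself, as a subspace contains \<open>0\<close>; this identifies the constant
  of the supporting plane.\<close>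

lemma support_normal:
  assumes "p \<in> M"
  obtains n where "n \<noteq> 0" "\<And>t. t \<in> tangent_plane A f p \<Longrightarrow> n \<bullet> t = 0"
    "\<And>z. nrm z \<le> 1 \<Longrightarrow> n \<bullet> z \<le> n \<bullet> \<eta> p"
proof -
  let ?T = "tangent_plane A f p"
  have "birkhoff_orthogonal nrm (\<eta> p) ?T"
    using normal_field assms unfolding birkhoff_normal_field_def by blast
  then have T: "subspace ?T" and "supporting_plane ((\<lambda>h. \<eta> p + h) ` ?T) (unit_ball nrm)"
    using nrm_eta[OF assms] unfolding birkhoff_orthogonal_def by auto
  then obtain n b where n: "n \<noteq> 0" "(\<lambda>h. \<eta> p + h) ` ?T = {x. n \<bullet> x = b}" "\<forall>x\<in>unit_ball nrm. n \<bullet> x \<le> b"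
    unfolding supporting_plane_def by blast
  have pl: "n \<bullet> (\<eta> p + h) = b" if "h \<in> ?T" for h
    using that n(2) by (metis (mono_tags, lifting) imageI mem_Collect_eq)
  have b: "n \<bullet> \<eta> p = b" using pl[OF subspace_0[OF T]] by simp
  show thesis
  proof (rule that[OF n(1)])
    show "n \<bullet> t = 0" if "t \<in> ?T" for t using pl[OF that] b by (simp add: inner_add_right)
    show "n \<bullet> z \<le> n \<bullet> \<eta> p" if "nrm z \<le> 1" for z
      using n(3) that unfolding b unit_ball_def by blast
  qed
qed

lemma birkhoff_patch_chart:
  assumes c: "c \<in> A"
  shows "birkhoff_patch (unit_sphere nrm) (coord_dom c) (coord_rep c f) (coord_rep c \<eta>)"
proof
  show "locally_smooth_graph (unit_sphere nrm)" "positive_gauss_curvature (unit_sphere nrm)"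
    using admissible unfolding admissible_norm_def by blast+
  show "open (coord_dom c)" "smooth_on (coord_dom c) (coord_rep c f)" "smooth_on (coord_dom c) (coord_rep c \<eta>)"
    using chart_open c smooth_coord_rep smooth_f smooth_eta by blast+
  show "coord_rep c \<eta> ` coord_dom c \<subseteq> unit_sphere nrm"
    using nrm_eta chart_subset[OF c] by (auto simp: coord_rep_chart c unit_sphere_def)
  fix x assume "x \<in> coord_dom c"
  then obtain p where p: "p \<in> fst c" "x = snd c p" by blast
  then have pM: "p \<in> M" using chart_subset[OF c] by blast
  show "inj (fd (coord_rep c f) x)"
    using inj_coord_differential[OF c p(1)] unfolding coord_differential_def p(2) .
  obtain n where n: "n \<noteq> 0" "\<And>t. t \<in> tangent_plane A f p \<Longrightarrow> n \<bullet> t = 0"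
    "\<And>z. nrm z \<le> 1 \<Longrightarrow> n \<bullet> z \<le> n \<bullet> \<eta> p"
    by (rule support_normal[OF pM], rule that)
  have "n \<bullet> fd (coord_rep c f) x w = 0" for w
    by (rule n(2)) (simp add: tangent_plane_chart[OF c p(1)] coord_differential_def p(2))
  moreover have "\<forall>z\<in>unit_sphere nrm. n \<bullet> z \<le> n \<bullet> coord_rep c \<eta> x"
    using n(3) unfolding p(2) coord_rep_chart[OF c p(1)] unit_sphere_def by simp
  ultimately show "\<exists>n. n \<noteq> 0 \<and> (\<forall>w. n \<bullet> fd (coord_rep c f) x w = 0) \<and>
      (\<forall>z\<in>unit_sphere nrm. n \<bullet> z \<le> n \<bullet> coord_rep c \<eta> x)"
    using n(1) by blast
qed

lemma diff_coord_eta: "c \<in> A \<Longrightarrow> p \<in> fst c \<Longrightarrow> coord_rep c \<eta> differentiable (at (snd c p))"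
  using smooth_on_differentiable[OF smooth_coord_rep[OF _ smooth_eta]] by blast

lemma principal_curvatures_chart:
  assumes c: "c \<in> A" "p \<in> fst c"
  shows "principal_curvatures A f \<eta> p =
    {kappa1 (coord_rep c f) (coord_rep c \<eta>) (snd c p), kappa2 (coord_rep c f) (coord_rep c \<eta>) (snd c p)}"
proof -
  interpret birkhoff_patch "unit_sphere nrm" "coord_dom c" "coord_rep c f" "coord_rep c \<eta>"
    by (rule birkhoff_patch_chart[OF c(1)])
  have u: "snd c p \<in> coord_dom c" using c by blast
  have lin: "linear (coord_differential c f p)"
    unfolding coord_differential_def by (rule fd_linear[OF diff_coord_f[OF c]])
  have nz: "coord_differential c f p v \<noteq> 0 \<longleftrightarrow> v \<noteq> 0" for v
    using inj_coord_differential[OF c] linear_0[OF lin] by (metis injD)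
  have "(\<exists>v. principal_direction A f \<eta> p \<mu> v) \<longleftrightarrow>
      (\<exists>a. a \<noteq> 0 \<and> coord_differential c \<eta> p a = \<mu> *\<^sub>R coord_differential c f p a)" for \<mu>
    unfolding principal_direction_def tangent_plane_chart[OF c]
    using deriv_along_chart[OF c diff_coord_eta[OF c]] nz by auto
  then show ?thesis
    unfolding principal_curvatures_def eigenvalues_eq[OF u, symmetric] coord_differential_def by simp
qed

lemma curv_chart:
  assumes c: "c \<in> A" "p \<in> fst c"
  shows "curv1 A f \<eta> p = kappa1 (coord_rep c f) (coord_rep c \<eta>) (snd c p)"
    and "curv2 A f \<eta> p = kappa2 (coord_rep c f) (coord_rep c \<eta>) (snd c p)"
proof -
  interpret birkhoff_patch "unit_sphere nrm" "coord_dom c" "coord_rep c f" "coord_rep c \<eta>"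
    by (rule birkhoff_patch_chart[OF c(1)])
  have "kappa2 (coord_rep c f) (coord_rep c \<eta>) (snd c p) \<le> kappa1 (coord_rep c f) (coord_rep c \<eta>) (snd c p)"
    using kappa_roots(3)[of "snd c p"] c by blast
  then show "curv1 A f \<eta> p = kappa1 (coord_rep c f) (coord_rep c \<eta>) (snd c p)"
    and "curv2 A f \<eta> p = kappa2 (coord_rep c f) (coord_rep c \<eta>) (snd c p)"
    unfolding curv1_def curv2_def principal_curvatures_chart[OF c] by auto
qed

lemma curv2_le_curv1: "p \<in> M \<Longrightarrow> curv2 A f \<eta> p \<le> curv1 A f \<eta> p"
proof -
  assume "p \<in> M"
  then obtain c where c: "c \<in> A" "p \<in> fst c" using chart_exists by blast
  interpret birkhoff_patch "unit_sphere nrm" "coord_dom c" "coord_rep c f" "coord_rep c \<eta>"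
    by (rule birkhoff_patch_chart[OF c(1)])
  show ?thesis unfolding curv_chart[OF c] using kappa_roots(3)[of "snd c p"] c by blast
qed

lemma curv1_continuous: "continuous_on M (curv1 A f \<eta>)"
proof (rule continuous_on_chartI)
  fix c assume c: "c \<in> A"
  interpret birkhoff_patch "unit_sphere nrm" "coord_dom c" "coord_rep c f" "coord_rep c \<eta>"
    by (rule birkhoff_patch_chart[OF c])
  show "continuous_on (coord_dom c) (coord_rep c (curv1 A f \<eta>))"
    by (rule continuous_on_eq[OF kappa1_continuous]) (auto simp: coord_rep_chart c curv_chart[OF c])
qed

end

section \<open>Support points of a strictly convex norm\<close>

lemma is_norm_imp_convex:
  assumes "is_norm nrm"
  shows "convex {z. nrm z < 1}" "nrm x \<le> 1 \<Longrightarrow> nrm y \<le> 1 \<Longrightarrow> z \<in> closed_segment x y \<Longrightarrow> nrm z \<le> 1"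
proof -
  have tri: "nrm (a *\<^sub>R x + b *\<^sub>R y) \<le> a * nrm x + b * nrm y" if "0 \<le> a" "0 \<le> b" for a b x y
  proof -
    have "nrm (a *\<^sub>R x + b *\<^sub>R y) \<le> nrm (a *\<^sub>R x) + nrm (b *\<^sub>R y)"
      using assms unfolding is_norm_def by blast
    moreover have "nrm (a *\<^sub>R x) = a * nrm x" "nrm (b *\<^sub>R y) = b * nrm y"
      using assms that unfolding is_norm_def by auto
    ultimately show ?thesis by simp
  qed
  show "convex {z. nrm z < 1}"
  proof (rule convexI)
    fix x y and a b :: real
    assume "x \<in> {z. nrm z < 1}" "y \<in> {z. nrm z < 1}" and ab: "0 \<le> a" "0 \<le> b" "a + b = 1"
    then have "a * nrm x + b * nrm y < 1" using convex_bound_lt[of "nrm x" 1 "nrm y" a b] by simp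
    then show "a *\<^sub>R x + b *\<^sub>R y \<in> {z. nrm z < 1}" using tri[OF ab(1,2), of x y] by simp
  qed
  assume xy: "nrm x \<le> 1" "nrm y \<le> 1" and "z \<in> closed_segment x y"
  then obtain t where t: "0 \<le> t" "t \<le> 1" "z = (1 - t) *\<^sub>R x + t *\<^sub>R y"
    unfolding closed_segment_def by auto
  have "(1 - t) * nrm x + t * nrm y \<le> 1" using convex_bound_le[of "nrm x" 1 "nrm y" "1 - t" t] xy t by simp
  then show "nrm z \<le> 1" using tri[of "1 - t" t x y] t by simp
qed

text \<open>A linear function maximal at both \<open>x\<close> and \<open>y\<close> is constant on the segment between them, so this segment
  cannot enter the interior of the ball and lies in the unit sphere, against strict convexity.\<close>

lemma support_point_unique:
  assumes adm: "admissible_norm nrm" and n: "n \<noteq> 0" and x: "nrm x = 1" and y: "nrm y = 1"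
    and max: "\<And>z. nrm z \<le> 1 \<Longrightarrow> n \<bullet> z \<le> n \<bullet> x" and eq: "n \<bullet> y = n \<bullet> x"
  shows "x = y"
proof (rule ccontr)
  assume "x \<noteq> y"
  have N: "is_norm nrm" using adm unfolding admissible_norm_def by blast
  have scale: "nrm (a *\<^sub>R z) = \<bar>a\<bar> * nrm z" and pos: "z \<noteq> 0 \<Longrightarrow> nrm z > 0" and nn: "nrm z \<ge> 0" for a z
    using N unfolding is_norm_def by (auto simp: order_less_le)
  have normalise: "n \<bullet> z \<le> nrm z * (n \<bullet> x)" if "z \<noteq> 0" for z
  proof -
    have "nrm (inverse (nrm z) *\<^sub>R z) \<le> 1" using pos[OF that] by (simp add: scale)
    from max[OF this]
    have "n \<bullet> z / nrm z \<le> n \<bullet> x" by (simp add: divide_inverse mult.commute)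
    then show ?thesis using pos[OF that] by (simp add: pos_divide_le_eq mult.commute)
  qed
  have "0 < n \<bullet> n" using n by simp
  also have "\<dots> \<le> nrm n * (n \<bullet> x)" by (rule normalise[OF n])
  finally have nx: "n \<bullet> x > 0" using pos[OF n] by (simp add: zero_less_mult_iff)
  have "closed_segment x y \<subseteq> unit_sphere nrm"
  proof
    fix z assume z: "z \<in> closed_segment x y"
    then obtain t where t: "z = (1 - t) *\<^sub>R x + t *\<^sub>R y" unfolding closed_segment_def by auto
    have nz: "n \<bullet> z = n \<bullet> x" unfolding t using eq by (simp add: inner_add_right algebra_simps)
    then have "z \<noteq> 0" using nx by auto
    from normalise[OF this] have "1 \<le> nrm z" using nz nx by simp
    moreover have "nrm z \<le> 1" using is_norm_imp_convex(2)[OF N _ _ z] x y by simp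
    ultimately show "z \<in> unit_sphere nrm" unfolding unit_sphere_def by simp
  qed
  then show False using adm \<open>x \<noteq> y\<close> unfolding admissible_norm_def by blast
qed

text \<open>Separate \<open>y\<close> from the open unit ball and pass to the closed ball by scaling.\<close>

lemma support_exists:
  assumes N: "is_norm nrm" and y: "nrm y = 1"
  obtains n where "n \<noteq> 0" "\<And>z. nrm z \<le> 1 \<Longrightarrow> n \<bullet> z \<le> n \<bullet> y"
proof -
  have 0: "0 \<in> {z. nrm z < 1}" using N unfolding is_norm_def by (metis mem_Collect_eq zero_less_one)
  then obtain n b where n: "n \<noteq> 0" "\<And>z. nrm z < 1 \<Longrightarrow> n \<bullet> z \<le> b" "b \<le> n \<bullet> y"
    using separating_hyperplane_sets[of "{z. nrm z < 1}" "{y}"] is_norm_imp_convex(1)[OF N] y by auto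
  have b: "b \<ge> 0" using n(2)[of 0] 0 by simp
  have "n \<bullet> z \<le> b" if "nrm z \<le> 1" for z
  proof (rule ccontr)
    assume "\<not> ?thesis"
    then have gt: "n \<bullet> z > b" by simp
    \<comment> \<open>Shrinking \<open>z\<close> moves its value halfway down to \<open>b\<close>, still above the bound for the open ball.\<close>
    define t where "t = (n \<bullet> z + b) / (2 * (n \<bullet> z))"
    have t: "0 < t" "t < 1" using gt b by (auto simp: t_def field_simps)
    have "nrm (t *\<^sub>R z) = t * nrm z" using N t unfolding is_norm_def by simp
    also have "\<dots> \<le> t" using that t mult_left_mono[of "nrm z" 1 t] by simp
    finally have "nrm (t *\<^sub>R z) < 1" using t by simp
    then have "t * (n \<bullet> z) \<le> b" using n(2)[of "t *\<^sub>R z"] by simp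
    moreover have "t * (n \<bullet> z) = (n \<bullet> z + b) / 2" using gt b by (simp add: t_def)
    ultimately show False using gt by simp
  qed
  then show thesis using that[OF n(1)] n(3) by (meson order_trans)
qed

context birkhoff_surface
begin

section \<open>Totally umbilic surfaces\<close>

text \<open>Since \<open>d(\<eta> - \<mu> f) = 0\<close>, the map \<open>\<eta> - \<mu> f\<close> is constant on the connected surface, so it suffices to show that
  \<open>\<eta>\<close> attains every unit vector \<open>y\<close>. Let \<open>n\<close> support the ball at \<open>y\<close>, and let \<open>p\<close> maximize \<open>n \<bullet> \<eta>\<close> on the compact
  surface. Then \<open>n\<close> is normal to the tangent plane at \<open>p\<close>, so \<open>\<eta> p\<close> supports the ball in direction \<open>n\<close> or
  \<open>- n\<close>. In the second case \<open>n \<bullet> \<eta>\<close> would be constant at the minimum of \<open>n\<close> on the ball, so that \<open>\<eta>\<close> would be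
  constant by strict convexity. In the first case \<open>\<eta> p = y\<close>, again by strict convexity.\<close>

lemma totally_umbilic_imp_minkowski_sphere:
  assumes M: "compact M" "connected M" "M \<noteq> {}" and l: "\<mu> \<noteq> 0"
    and umb: "\<And>c p v. c \<in> A \<Longrightarrow> p \<in> fst c \<Longrightarrow> coord_differential c \<eta> p v = \<mu> *\<^sub>R coord_differential c f p v"
  shows "minkowski_sphere nrm (f ` M)"
proof -
  have N: "is_norm nrm" using admissible unfolding admissible_norm_def by blast
  have "(\<lambda>p. \<eta> p - \<mu> *\<^sub>R f p) constant_on M"
  proof (rule locally_constant_imp_constant[OF M(2)])
    fix p assume "p \<in> M"
    then obtain c where c: "c \<in> A" "p \<in> fst c" using chart_exists by blast
    show "\<exists>T. openin (top_of_set M) T \<and> p \<in> T \<and> (\<forall>x\<in>T. \<eta> x - \<mu> *\<^sub>R f x = \<eta> p - \<mu> *\<^sub>R f p)"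
    proof (rule locally_constant_chart[OF c])
      fix x assume "x \<in> coord_dom c"
      then obtain q where q: "q \<in> fst c" "x = snd c q" by blast
      have "((\<lambda>x. coord_rep c \<eta> x - \<mu> *\<^sub>R coord_rep c f x) has_derivative
          (\<lambda>v. coord_differential c \<eta> q v - \<mu> *\<^sub>R coord_differential c f q v)) (at x)"
        unfolding coord_differential_def q(2)
        by (intro has_derivative_diff has_derivative_scaleR_right fd_works diff_coord_eta diff_coord_f c(1) q(1))
      then show "(coord_rep c (\<lambda>p. \<eta> p - \<mu> *\<^sub>R f p) has_derivative (\<lambda>h. 0)) (at x)"
        using umb[OF c(1) q(1)] by (simp add: coord_rep_def o_def)
    qed
  qed
  then obtain b where b: "\<And>p. p \<in> M \<Longrightarrow> \<eta> p - \<mu> *\<^sub>R f p = b" unfolding constant_on_def by blast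
  define z where "z = - (inverse \<mu> *\<^sub>R b)"
  have eta: "\<eta> p = \<mu> *\<^sub>R (f p - z)" if "p \<in> M" for p
    using b[OF that] l by (simp add: z_def scaleR_add_right algebra_simps)
  have scale: "nrm (\<mu> *\<^sub>R w) = \<bar>\<mu>\<bar> * nrm w" for w using N unfolding is_norm_def by blast
  have onto: "\<exists>p\<in>M. \<eta> p = y" if y: "nrm y = 1" for y
  proof -
    obtain n where n: "n \<noteq> 0" "\<And>w. nrm w \<le> 1 \<Longrightarrow> n \<bullet> w \<le> n \<bullet> y" using support_exists[OF N y] by blast
    have "continuous_on M (\<lambda>p. n \<bullet> \<eta> p)"
      by (intro continuous_intros continuous_on_smooth_map smooth_eta)
    then obtain p where p: "p \<in> M" "\<And>q. q \<in> M \<Longrightarrow> n \<bullet> \<eta> q \<le> n \<bullet> \<eta> p"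
      using continuous_attains_sup[OF M(1,3)] by blast
    obtain c where c: "c \<in> A" "p \<in> fst c" using chart_exists p by blast
    interpret birkhoff_patch "unit_sphere nrm" "coord_dom c" "coord_rep c f" "coord_rep c \<eta>"
      by (rule birkhoff_patch_chart[OF c(1)])
    have u: "snd c p \<in> coord_dom c" using c by blast
    have n_tangent: "n \<bullet> coord_differential c f p v = 0" for v
    proof -
      have "fd (\<lambda>x. coord_rep c \<eta> x \<bullet> n) (snd c p) v = 0"
      proof (rule max_imp_fd_eq_0[OF open_U u])
        show "(\<lambda>x. coord_rep c \<eta> x \<bullet> n) differentiable (at (snd c p))"
          by (intro differentiable_inner diff_E u differentiable_const)
        show "coord_rep c \<eta> x \<bullet> n \<le> coord_rep c \<eta> (snd c p) \<bullet> n" if "x \<in> coord_dom c" for x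
          using that p(2) chart_subset[OF c(1)] c by (auto simp: coord_rep_chart inner_commute)
      qed
      then have "coord_differential c \<eta> p v \<bullet> n = 0"
        unfolding coord_differential_def using fd_inner_const[OF diff_E[OF u], of n v] by simp
      then show ?thesis using umb[OF c] l by (simp add: inner_commute)
    qed
    obtain m where m: "m \<noteq> 0" "\<And>t. t \<in> tangent_plane A f p \<Longrightarrow> m \<bullet> t = 0"
      "\<And>w. nrm w \<le> 1 \<Longrightarrow> m \<bullet> w \<le> m \<bullet> \<eta> p"
      by (rule support_normal[OF p(1)], rule that)
    have m_tangent: "m \<bullet> coord_differential c f p v = 0" for v
      by (rule m(2)) (simp add: tangent_plane_chart[OF c])
    let ?N = "normal_cross (coord_rep c f) (snd c p)"
    have N0: "?N \<noteq> 0" by (rule normal_nonzero[OF u])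
    obtain s where s: "n = s *\<^sub>R ?N"
      using parallel_cross3_if_orthogonal[of "partial 1 (coord_rep c f) (snd c p)" "partial 2 (coord_rep c f) (snd c p)" n]
        N0 n_tangent unfolding normal_cross_def partial_def coord_differential_def by metis
    obtain s' where s': "m = s' *\<^sub>R ?N"
      using parallel_cross3_if_orthogonal[of "partial 1 (coord_rep c f) (snd c p)" "partial 2 (coord_rep c f) (snd c p)" m]
        N0 m_tangent unfolding normal_cross_def partial_def coord_differential_def by metis
    have "s \<noteq> 0" "s' \<noteq> 0" using s s' n(1) m(1) by auto
    \<comment> \<open>The support normal \<open>m\<close> of \<open>\<eta> p\<close> and \<open>n\<close> are parallel; the sign of \<open>r\<close> decides between the two cases.\<close>
    define r where "r = s' / s"
    have r: "m = r *\<^sub>R n" "r \<noteq> 0" using s s' \<open>s \<noteq> 0\<close> \<open>s' \<noteq> 0\<close> by (simp_all add: r_def)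
    have "r > 0"
    proof (rule ccontr)
      assume "\<not> r > 0"
      then have "r < 0" using r by simp
      have const: "\<eta> q = \<eta> p" if "q \<in> M" for q
      proof (rule support_point_unique[OF admissible m(1), symmetric])
        show "nrm (\<eta> p) = 1" "nrm (\<eta> q) = 1" using nrm_eta p that by blast+
        show "m \<bullet> w \<le> m \<bullet> \<eta> p" if "nrm w \<le> 1" for w by (rule m(3)[OF that])
        have "m \<bullet> \<eta> q \<le> m \<bullet> \<eta> p" using m(3) nrm_eta[OF that] by simp
        moreover have "m \<bullet> \<eta> p \<le> m \<bullet> \<eta> q" unfolding r using p(2)[OF that] \<open>r < 0\<close> by simp
        ultimately show "m \<bullet> \<eta> q = m \<bullet> \<eta> p" by simp
      qed
      have "fd (coord_rep c \<eta>) (snd c p) = fd (\<lambda>x. \<eta> p) (snd c p)"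
      proof (rule fd_cong[OF open_U u])
        fix x assume "x \<in> coord_dom c"
        then obtain q where q: "q \<in> fst c" "x = snd c q" by blast
        then have "q \<in> M" using chart_subset[OF c(1)] by blast
        then show "coord_rep c \<eta> x = \<eta> p" unfolding q(2) coord_rep_chart[OF c(1) q(1)] by (rule const)
      qed
      then have "coord_differential c \<eta> p v = 0" for v
        unfolding coord_differential_def by (simp add: frechet_derivative_const)
      then have "coord_differential c f p v = 0" for v using umb[OF c, of v] l by simp
      then have "partial 1 (coord_rep c f) (snd c p) = 0" unfolding partial_def coord_differential_def by simp
      then show False using N0 unfolding normal_cross_def by simp
    qed
    have "\<eta> p = y"
    proof (rule support_point_unique[OF admissible m(1)])
      show "m \<bullet> y = m \<bullet> \<eta> p"
      proof (rule antisym)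
        show "m \<bullet> y \<le> m \<bullet> \<eta> p" using m(3) y by simp
        show "m \<bullet> \<eta> p \<le> m \<bullet> y" unfolding r using n(2)[of "\<eta> p"] nrm_eta[OF p(1)] \<open>r > 0\<close> by simp
      qed
    qed (use nrm_eta p y m(3) in auto)
    then show ?thesis using p(1) by blast
  qed
  have "f ` M = {x. nrm (x - z) = 1 / \<bar>\<mu>\<bar>}"
  proof (intro set_eqI iffI)
    fix x assume "x \<in> f ` M"
    then obtain p where p: "p \<in> M" "x = f p" by blast
    then have "\<bar>\<mu>\<bar> * nrm (x - z) = 1" using nrm_eta[OF p(1)] eta[OF p(1)] scale by simp
    then show "x \<in> {x. nrm (x - z) = 1 / \<bar>\<mu>\<bar>}" using l by (simp add: field_simps)
  next
    fix x assume "x \<in> {x. nrm (x - z) = 1 / \<bar>\<mu>\<bar>}"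
    then have "nrm (\<mu> *\<^sub>R (x - z)) = 1" using l by (simp add: scale)
    then obtain p where p: "p \<in> M" "\<eta> p = \<mu> *\<^sub>R (x - z)" using onto by blast
    then have "x = f p" using eta[OF p(1)] l by simp
    then show "x \<in> f ` M" using p(1) by blast
  qed
  then show ?thesis unfolding minkowski_sphere_def using l by (intro exI[of _ z] exI[of _ "1 / \<bar>\<mu>\<bar>"]) simp
qed

section \<open>Elliptic points and the sign of the curvature\<close>

lemma gauss_curvature_positive_somewhere:
  assumes M: "compact M" "M \<noteq> {}"
  obtains p where "p \<in> M" "curv1 A f \<eta> p * curv2 A f \<eta> p > 0"
proof -
  have "continuous_on M (\<lambda>p. norm (f p))"
    by (intro continuous_intros continuous_on_smooth_map smooth_f)
  then obtain p where p: "p \<in> M" "\<And>q. q \<in> M \<Longrightarrow> norm (f q) \<le> norm (f p)"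
    using continuous_attains_sup[OF M] by blast
  obtain c where c: "c \<in> A" "p \<in> fst c" using chart_exists p by blast
  interpret birkhoff_patch "unit_sphere nrm" "coord_dom c" "coord_rep c f" "coord_rep c \<eta>"
    by (rule birkhoff_patch_chart[OF c(1)])
  have u: "snd c p \<in> coord_dom c" using c by blast
  have "shape_det (coord_rep c f) (coord_rep c \<eta>) (snd c p) > 0"
    by (rule shape_det_pos_at_farthest_point[OF u])
      (use p(2) chart_subset[OF c(1)] c in \<open>auto simp: coord_rep_chart\<close>)
  then have "curv1 A f \<eta> p * curv2 A f \<eta> p > 0"
    unfolding curv_chart[OF c] kappa_roots(2)[OF u] .
  then show thesis using that p(1) by blast
qed

text \<open>Both principal curvatures may be negative when \<open>\<eta>\<close> points the other way; connectedness rules out a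
  change of sign.\<close>

lemma connected_curv1_positive:
  assumes "connected M" "\<And>q. q \<in> M \<Longrightarrow> curv1 A f \<eta> q \<noteq> 0" "p \<in> M" "curv1 A f \<eta> p > 0" "q \<in> M"
  shows "curv1 A f \<eta> q > 0"
proof (rule ccontr)
  assume "\<not> ?thesis"
  then have "curv1 A f \<eta> q \<le> 0" by simp
  have "connected (curv1 A f \<eta> ` M)" by (rule connected_continuous_image[OF curv1_continuous assms(1)])
  then have "0 \<in> curv1 A f \<eta> ` M"
    using connectedD_interval[of _ "curv1 A f \<eta> q" "curv1 A f \<eta> p" 0] assms \<open>curv1 A f \<eta> q \<le> 0\<close> by auto
  then show False using assms(2) by force
qed

text \<open>Let \<open>l\<close> be the maximal value, so that \<open>k = l\<^sup>2\<close>. At every point \<open>\<lambda>\<^sub>2 \<le> \<lambda>\<^sub>1 \<le> l\<close> and \<open>\<lambda>\<^sub>1 \<lambda>\<^sub>2 = l\<^sup>2\<close>. As all three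
  numbers have the same sign, this leaves only \<open>\<lambda>\<^sub>1 = \<lambda>\<^sub>2 = l\<close>.\<close>

lemma umbilic_maximum_imp_totally_umbilic:
  assumes M: "connected M" and k: "k > 0" "\<And>q. q \<in> M \<Longrightarrow> curv1 A f \<eta> q * curv2 A f \<eta> q = k"
    and p: "p \<in> M" "umbilic A f \<eta> p" and max: "\<And>q. q \<in> M \<Longrightarrow> curv1 A f \<eta> q \<le> curv1 A f \<eta> p"
    and q: "q \<in> M"
  shows "curv1 A f \<eta> q = curv1 A f \<eta> p" "curv2 A f \<eta> q = curv1 A f \<eta> p"
proof -
  define l where "l = curv1 A f \<eta> p"
  define a b where "a = curv1 A f \<eta> q" and "b = curv2 A f \<eta> q"
  have l: "l * l = k" using k(2)[OF p(1)] p(2) by (simp add: l_def umbilic_def)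
  have ab: "a * b = k" "b \<le> a" "a \<le> l"
    using k(2)[OF q] curv2_le_curv1[OF q] max[OF q] by (simp_all add: a_def b_def l_def)
  have nz: "curv1 A f \<eta> r \<noteq> 0" if "r \<in> M" for r using k(1) k(2)[OF that] by auto
  have "a = l \<and> b = l"
  proof (cases "l > 0")
    case True
    then have "a > 0" unfolding a_def l_def using connected_curv1_positive[OF M nz p(1) _ q] by blast
    moreover have "b > 0" using \<open>a > 0\<close> ab(1) k(1) by (metis zero_less_mult_pos)
    moreover have "a * b \<le> l * b" "l * b \<le> l * l" using ab \<open>b > 0\<close> True by (auto intro: mult_right_mono mult_left_mono)
    ultimately have "a * b = l * b" "l * b = l * l" using ab(1) l by linarith+
    then show ?thesis using \<open>b > 0\<close> True by simp
  next
    case False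
    then have "l < 0" using l k(1) by (cases "l = 0") auto
    moreover have "a < 0" "b < 0" using ab \<open>l < 0\<close> by linarith+
    moreover have "a * b \<ge> l * b" "l * b \<ge> l * l"
      using ab \<open>l < 0\<close> \<open>b < 0\<close> by (auto intro: mult_right_mono_neg mult_left_mono_neg)
    ultimately have "a * b = l * b" "l * b = l * l" using ab(1) l by linarith+
    then show ?thesis using \<open>b < 0\<close> \<open>l < 0\<close> by simp
  qed
  then show "curv1 A f \<eta> q = curv1 A f \<eta> p" "curv2 A f \<eta> q = curv1 A f \<eta> p"
    by (simp_all add: a_def b_def l_def)
qed

section \<open>Maxima of the greatest principal curvature\<close>

text \<open>The hypothesis on the bracket, applied to the components of a vector-valued map \<open>h\<close> and read in a single
  chart: if \<open>H\<^sub>i\<close> is the derivative of \<open>h\<close> along \<open>V\<^sub>i\<close>, then \<open>V\<^sub>1(H\<^sub>2) = V\<^sub>2(H\<^sub>1)\<close>. It is used with \<open>h = f\<close>, where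
  \<open>H\<^sub>i = V\<^sub>i\<close>, and with \<open>h = \<eta>\<close>, where \<open>H\<^sub>i = \<lambda>\<^sub>i V\<^sub>i\<close>.\<close>

lemma commuting_fields_derivative:
  fixes h :: "'m \<Rightarrow> real^3"
  assumes c: "c \<in> A" and W: "openin (top_of_set M) W"
    and br: "bracket_zero_on A f W V1 V2" and h: "smooth_map_on A M h"
    and v: "\<And>q. q \<in> fst c \<inter> W \<Longrightarrow> coord_differential c f q (v1 (snd c q)) = V1 q"
      "\<And>q. q \<in> fst c \<inter> W \<Longrightarrow> coord_differential c f q (v2 (snd c q)) = V2 q"
    and H: "\<And>q. q \<in> fst c \<inter> W \<Longrightarrow> coord_differential c h q (v1 (snd c q)) = H1 (snd c q)"
      "\<And>q. q \<in> fst c \<inter> W \<Longrightarrow> coord_differential c h q (v2 (snd c q)) = H2 (snd c q)"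
    and p: "p \<in> fst c \<inter> W" and dH: "H1 differentiable (at (snd c p))" "H2 differentiable (at (snd c p))"
  shows "fd H2 (snd c p) (v1 (snd c p)) = fd H1 (snd c p) (v2 (snd c p))"
proof (rule euclidean_eqI)
  fix e :: "real^3" assume "e \<in> Basis"
  define g where "g q = h q \<bullet> e" for q
  let ?T = "snd c ` (fst c \<inter> W)"
  have T: "open ?T" "snd c p \<in> ?T" using chart_image_open[OF c W] p by auto
  have rep: "coord_rep d g = (\<lambda>x. coord_rep d h x \<bullet> e)" for d by (simp add: coord_rep_def g_def o_def)
  have "smooth_map_on A W g"
    unfolding smooth_map_on_def rep smooth_on_def
  proof (intro ballI allI ck_on_inner[OF _ _ ck_on_const])
    fix d k assume d: "d \<in> A"
    show "open (snd d ` (fst d \<inter> W))" using chart_image_open[OF d W] .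
    show "ck_on k (snd d ` (fst d \<inter> W)) (coord_rep d h)"
      by (rule ck_on_subset[OF smooth_onD[OF smooth_coord_rep[OF d h]]]) blast
  qed
  then have br_g: "deriv_along A f (\<lambda>r. deriv_along A f g r (V2 r)) p (V1 p) =
      deriv_along A f (\<lambda>r. deriv_along A f g r (V1 r)) p (V2 p)"
    using br[unfolded bracket_zero_on_def, rule_format, of g p] p by simp
  have dh: "coord_rep c h differentiable (at (snd c q))" if "q \<in> fst c" for q
    using smooth_on_differentiable[OF smooth_coord_rep[OF c h]] that by blast
  have dg: "coord_rep c g differentiable (at (snd c q))" if "q \<in> fst c" for q
    unfolding rep by (intro differentiable_inner dh that differentiable_const)
  have first: "deriv_along A f g q (V q) = H (snd c q) \<bullet> e"
    if "q \<in> fst c \<inter> W" and "coord_differential c f q (w (snd c q)) = V q"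
      and "coord_differential c h q (w (snd c q)) = H (snd c q)" for q V w H
  proof -
    have "deriv_along A f g q (V q) = coord_differential c g q (w (snd c q))"
      using deriv_along_chart[OF c _ dg, of q "w (snd c q)"] that by simp
    also have "\<dots> = coord_differential c h q (w (snd c q)) \<bullet> e"
      unfolding coord_differential_def rep using fd_inner_const[OF dh] that by blast
    finally show ?thesis using that by simp
  qed
  have second: "deriv_along A f (\<lambda>r. deriv_along A f g r (V r)) p (V' p) = fd H (snd c p) (w' (snd c p)) \<bullet> e"
    if V: "\<And>q. q \<in> fst c \<inter> W \<Longrightarrow> coord_differential c f q (w (snd c q)) = V q"
      and H: "\<And>q. q \<in> fst c \<inter> W \<Longrightarrow> coord_differential c h q (w (snd c q)) = H (snd c q)"
      and V': "coord_differential c f p (w' (snd c p)) = V' p"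
      and dH: "H differentiable (at (snd c p))" for V V' w w' H
  proof -
    let ?G = "\<lambda>r. deriv_along A f g r (V r)"
    have eq: "H x \<bullet> e = coord_rep c ?G x" if x: "x \<in> ?T" for x
    proof -
      obtain q where q: "q \<in> fst c \<inter> W" "x = snd c q" using x by blast
      have "coord_rep c ?G x = ?G q" unfolding q(2) using coord_rep_chart[OF c, of q ?G] q(1) by blast
      also have "\<dots> = H x \<bullet> e" unfolding q(2) by (rule first[where w = w and V = V and H = H, OF q(1) V[OF q(1)] H[OF q(1)]])
      finally show ?thesis by simp
    qed
    have dHe: "(\<lambda>x. H x \<bullet> e) differentiable (at (snd c p))"
      by (intro differentiable_inner dH differentiable_const)
    have "coord_rep c ?G differentiable (at (snd c p))"
      by (rule differentiable_cong_open[OF T eq dHe])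
    then have "deriv_along A f ?G p (V' p) = coord_differential c ?G p (w' (snd c p))"
      using deriv_along_chart[OF c, of p ?G "w' (snd c p)"] V' p by simp
    also have "\<dots> = fd (\<lambda>x. H x \<bullet> e) (snd c p) (w' (snd c p))"
      unfolding coord_differential_def using fd_cong[OF T eq] by simp
    also have "\<dots> = fd H (snd c p) (w' (snd c p)) \<bullet> e" by (rule fd_inner_const[OF dH])
    finally show ?thesis .
  qed
  show "fd H2 (snd c p) (v1 (snd c p)) \<bullet> e = fd H1 (snd c p) (v2 (snd c p)) \<bullet> e"
    using br_g second[where w = v2 and V = V2 and H = H2 and w' = v1 and V' = V1, OF v(2) H(2) v(1)[OF p] dH(2)]
      second[where w = v1 and V = V1 and H = H1 and w' = v2 and V' = V2, OF v(1) H(1) v(2)[OF p] dH(1)]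
    by simp
qed

lemma first_coefficient_eq:
  assumes indep: "\<And>s t. s *\<^sub>R v1 + t *\<^sub>R v2 = 0 \<Longrightarrow> s = 0" and "w = a *\<^sub>R v1 + b *\<^sub>R v2"
  shows "first_coefficient v1 v2 w = a"
  unfolding first_coefficient_def
proof (rule the_equality)
  fix a' assume "\<exists>b. w = a' *\<^sub>R v1 + b *\<^sub>R v2"
  then obtain b' where b': "w = a' *\<^sub>R v1 + b' *\<^sub>R v2" by blast
  have "(a' - a) *\<^sub>R v1 + (b' - b) *\<^sub>R v2 = (a' *\<^sub>R v1 + b' *\<^sub>R v2) - (a *\<^sub>R v1 + b *\<^sub>R v2)"
    by (simp add: algebra_simps)
  also have "\<dots> = 0" using assms(2) b' by simp
  finally have "a' - a = 0" by (rule indep)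
  then show "a' = a" by simp
qed (use assms in blast)

text \<open>Otherwise take a commuting principal frame and one chart around \<open>p\<close>, in which \<open>v\<^sub>i\<close>, \<open>X\<^sub>i\<close> and \<open>K\<^sub>i\<close> below are
  the coordinates of \<open>V\<^sub>i\<close>, the field \<open>V\<^sub>i\<close> and the curvature \<open>\<lambda>\<^sub>i\<close>. The Codazzi equation gives \<open>D\<^bsub>V\<^sub>1\<^esub>V\<^sub>2 = 0\<close> at
  \<open>p\<close> and identifies the coefficient \<open>f\<^sub>1\<close> with \<open>V\<^sub>2(\<lambda>\<^sub>1) / (\<lambda>\<^sub>2 - \<lambda>\<^sub>1)\<close> near \<open>p\<close>. Its derivative along \<open>V\<^sub>2\<close> at \<open>p\<close> is
  the second derivative of \<open>\<lambda>\<^sub>1\<close> divided by a negative number, hence nonnegative at a maximum.\<close>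

lemma coercive_maximum_imp_umbilic:
  assumes k: "k > 0" "\<And>q. q \<in> M \<Longrightarrow> curv1 A f \<eta> q * curv2 A f \<eta> q = k"
    and p: "p \<in> M" and max: "\<And>q. q \<in> M \<Longrightarrow> curv1 A f \<eta> q \<le> curv1 A f \<eta> p"
    and coercive: "coercively_convex_at M A f \<eta> p"
  shows "umbilic A f \<eta> p"
proof (rule ccontr)
  assume "\<not> umbilic A f \<eta> p"
  then obtain W V1 V2 where pW: "p \<in> W" and frame: "commuting_principal_frame M A f \<eta> W V1 V2"
    and coer: "deriv_along A f V2 p (V1 p) = 0 \<Longrightarrow>
      deriv_along A f (\<lambda>q. first_coefficient (V1 q) (V2 q) (deriv_along A f V2 q (V1 q))) p (V2 p) < 0"
    using coercive unfolding coercively_convex_at_def by blast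
  have W: "openin (top_of_set M) W" and nu: "\<And>q. q \<in> W \<Longrightarrow> \<not> umbilic A f \<eta> q"
    and tf: "tangent_field_on A f W V1" "tangent_field_on A f W V2"
    and pd: "\<And>q. q \<in> W \<Longrightarrow> principal_direction A f \<eta> q (curv1 A f \<eta> q) (V1 q)"
      "\<And>q. q \<in> W \<Longrightarrow> principal_direction A f \<eta> q (curv2 A f \<eta> q) (V2 q)"
    and br: "bracket_zero_on A f W V1 V2"
    using frame unfolding commuting_principal_frame_def by blast+
  obtain c where c: "c \<in> A" "p \<in> fst c" using chart_exists p by blast
  interpret birkhoff_patch "unit_sphere nrm" "coord_dom c" "coord_rep c f" "coord_rep c \<eta>"
    by (rule birkhoff_patch_chart[OF c(1)])
  define T where "T = snd c ` (fst c \<inter> W)"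
  define u where "u = snd c p"
  define F E where "F = coord_rep c f" and "E = coord_rep c \<eta>"
  define K1 K2 where "K1 = kappa1 F E" and "K2 = kappa2 F E"
  define X1 X2 where "X1 = coord_rep c V1" and "X2 = coord_rep c V2"
  define v1 v2 where "v1 = tangent_coords F X1" and "v2 = tangent_coords F X2"
  have T: "open T" "u \<in> T" "T \<subseteq> coord_dom c" using chart_image_open[OF c(1) W] c pW by (auto simp: T_def u_def)
  have X: "smooth_on T X1" "smooth_on T X2"
    using tf c unfolding tangent_field_on_def smooth_map_on_def T_def X1_def X2_def by blast+
  have K_eq: "K1 (snd c q) = curv1 A f \<eta> q" "K2 (snd c q) = curv2 A f \<eta> q" if "q \<in> fst c" for q
    using curv_chart[OF c(1) that] by (simp_all add: K1_def K2_def F_def E_def)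
  have K_neq: "K1 x \<noteq> K2 x" if "x \<in> T" for x
    using that nu by (auto simp: T_def K_eq umbilic_def)
  have disc: "shape_disc F E x > 0" if "x \<in> T" for x
  proof -
    have "shape_disc F E x = (K1 x - K2 x)\<^sup>2"
      using kappa_roots(4)[of x] T that by (auto simp: F_def E_def K1_def K2_def)
    then show ?thesis using K_neq[OF that] by simp
  qed
  have K_ck: "ck_on k T K1" "ck_on k T K2" for k
    using kappa_ck[OF T(1,3)] disc unfolding K1_def K2_def F_def E_def by blast+
  have dK: "K1 differentiable (at x)" "K2 differentiable (at x)" if "x \<in> T" for x
    using K_ck[of "Suc 0"] that by auto
  have prod: "K1 x * K2 x = k" if "x \<in> T" for x
    using that k(2) chart_subset[OF c(1)] by (auto simp: T_def K_eq)
  have K1_max: "K1 x \<le> K1 u" if "x \<in> T" for x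
    using that max chart_subset[OF c(1)] c by (auto simp: T_def u_def K_eq)
  have K1_crit: "fd K1 u w = 0" for w by (rule max_imp_fd_eq_0[OF T(1,2) dK(1)[OF T(2)] K1_max])
  have K1_nz: "K1 x \<noteq> 0" if "x \<in> T" for x using prod[OF that] k(1) by auto
  have K2_crit: "fd K2 u w = 0" for w
  proof -
    have "((\<lambda>x. K1 x * K2 x) has_derivative (\<lambda>w. K1 u * fd K2 u w + fd K1 u w * K2 u)) (at u)"
      by (intro has_derivative_mult fd_works dK T)
    then have "fd (\<lambda>x. K1 x * K2 x) u w = K1 u * fd K2 u w + fd K1 u w * K2 u" by (rule fd_apply_eqI)
    moreover have "fd (\<lambda>x. K1 x * K2 x) u = fd (\<lambda>x. k) u" by (rule fd_cong[OF T(1,2) prod])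
    ultimately show ?thesis using K1_crit K1_nz[OF T(2)] by (simp add: frechet_derivative_const)
  qed
  have in_plane: "coord_differential c f q (v1 (snd c q)) = V1 q" "coord_differential c f q (v2 (snd c q)) = V2 q"
    if q: "q \<in> fst c \<inter> W" for q
  proof -
    have q': "q \<in> fst c" "snd c q \<in> coord_dom c" using q by auto
    have *: "V q = coord_differential c f q (tangent_coords F (coord_rep c V) (snd c q))"
      if "tangent_field_on A f W V" for V
    proof -
      have "V q \<in> range (coord_differential c f q)"
        using that q tangent_plane_chart[OF c(1) q'(1)] unfolding tangent_field_on_def by blast
      then show ?thesis
        using fd_tangent_coords[OF q'(2), of "coord_rep c V"]
        by (simp add: coord_differential_def F_def coord_rep_chart[OF c(1) q'(1)])
    qed
    show "coord_differential c f q (v1 (snd c q)) = V1 q" "coord_differential c f q (v2 (snd c q)) = V2 q"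
      using *[OF tf(1)] *[OF tf(2)] by (simp_all add: v1_def v2_def X1_def X2_def)
  qed
  have X_eq: "X1 (snd c q) = V1 q" "X2 (snd c q) = V2 q" if "q \<in> fst c" for q
    using coord_rep_chart[OF c(1) that] by (simp_all add: X1_def X2_def)
  have eig: "coord_differential c \<eta> q (v1 (snd c q)) = K1 (snd c q) *\<^sub>R X1 (snd c q)"
    "coord_differential c \<eta> q (v2 (snd c q)) = K2 (snd c q) *\<^sub>R X2 (snd c q)"
    if q: "q \<in> fst c \<inter> W" for q
  proof -
    have q': "q \<in> fst c" "q \<in> W" using q by auto
    note d = deriv_along_chart[OF c(1) q'(1) diff_coord_eta[OF c(1) q'(1)]]
    show "coord_differential c \<eta> q (v1 (snd c q)) = K1 (snd c q) *\<^sub>R X1 (snd c q)"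
      "coord_differential c \<eta> q (v2 (snd c q)) = K2 (snd c q) *\<^sub>R X2 (snd c q)"
      using d[of "v1 (snd c q)"] d[of "v2 (snd c q)"] pd[OF q'(2)] in_plane[OF q]
      unfolding principal_direction_def K_eq[OF q'(1)] X_eq[OF q'(1)] by simp_all
  qed
  have dX: "X1 differentiable (at x)" "X2 differentiable (at x)" if "x \<in> T" for x
    using smooth_on_differentiable X that by blast+
  \<comment> \<open>The frame commutes: apply this to \<open>f\<close> and to \<open>\<eta>\<close>.\<close>
  have B1: "fd X2 x (v1 x) = fd X1 x (v2 x)" if x: "x \<in> T" for x
  proof -
    obtain q where q: "q \<in> fst c \<inter> W" "x = snd c q" using x unfolding T_def by blast
    show ?thesis unfolding q(2)
      by (rule commuting_fields_derivative[OF c(1) W br smooth_f, where p = q])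
        (use in_plane X_eq q dX[OF x] in auto)
  qed
  have B2: "fd (\<lambda>y. K2 y *\<^sub>R X2 y) x (v1 x) = fd (\<lambda>y. K1 y *\<^sub>R X1 y) x (v2 x)" if x: "x \<in> T" for x
  proof -
    obtain q where q: "q \<in> fst c \<inter> W" "x = snd c q" using x unfolding T_def by blast
    show ?thesis unfolding q(2)
      by (rule commuting_fields_derivative[OF c(1) W br smooth_eta, where p = q])
        (use in_plane eig q dX[OF x] dK[OF x] in \<open>auto intro: differentiable_scaleR\<close>)
  qed
  have cod: "(K2 x - K1 x) *\<^sub>R fd X2 x (v1 x) = fd K1 x (v2 x) *\<^sub>R X1 x - fd K2 x (v1 x) *\<^sub>R X2 x" if "x \<in> T" for x
    using codazzi[OF _ _ dX[OF that], of "v1 x" "v2 x"] B1[OF that] B2[OF that] disc[OF that] T(3) that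
    unfolding K1_def K2_def F_def E_def by blast
  have D12: "deriv_along A f V2 q (V1 q) = fd X2 (snd c q) (v1 (snd c q))" if q: "q \<in> fst c \<inter> W" for q
  proof -
    have "coord_rep c V2 differentiable (at (snd c q))" using dX(2)[of "snd c q"] q by (simp add: X2_def T_def)
    from deriv_along_chart[OF c(1) _ this, of "v1 (snd c q)"] in_plane(1)[OF q] q
    show ?thesis by (simp add: X2_def coord_differential_def)
  qed
  have "fd X2 u (v1 u) = 0"
    using cod[OF T(2)] K1_crit K2_crit K_neq[OF T(2)] by simp
  then have "deriv_along A f V2 p (V1 p) = 0" using D12[of p] c pW by (simp add: u_def)
  then have neg: "deriv_along A f (\<lambda>q. first_coefficient (V1 q) (V2 q) (deriv_along A f V2 q (V1 q))) p (V2 p) < 0"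
    (is "deriv_along A f ?\<Phi> p (V2 p) < 0") by (rule coer)
  have \<Phi>: "fd K1 x (v2 x) * inverse (K2 x - K1 x) = coord_rep c ?\<Phi> x" if x: "x \<in> T" for x
  proof -
    obtain q where q: "q \<in> fst c \<inter> W" "x = snd c q" using x unfolding T_def by blast
    have q': "q \<in> fst c" "q \<in> W" using q by auto
    have indep: "s = 0" if "s *\<^sub>R V1 q + t *\<^sub>R V2 q = 0" for s t
    proof -
      have linf: "linear (coord_differential c f q)" and line: "linear (coord_differential c \<eta> q)"
        unfolding coord_differential_def using fd_linear diff_coord_f diff_coord_eta c(1) q'(1) by blast+
      let ?a = "v1 (snd c q)" and ?b = "v2 (snd c q)"
      have "coord_differential c f q (s *\<^sub>R ?a + t *\<^sub>R ?b) = coord_differential c f q 0"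
        using that in_plane[OF q(1)] by (simp add: linear_add[OF linf] linear_scale[OF linf] linear_0[OF linf])
      then have "s *\<^sub>R ?a + t *\<^sub>R ?b = 0" using inj_coord_differential[OF c(1) q'(1)] by (metis injD)
      then have "coord_differential c \<eta> q (s *\<^sub>R ?a + t *\<^sub>R ?b) = 0" using linear_0[OF line] by simp
      then have "(s * K1 x) *\<^sub>R V1 q + (t * K2 x) *\<^sub>R V2 q = 0"
        using eig[OF q(1)] X_eq[OF q'(1)] q(2) by (simp add: linear_add[OF line] linear_scale[OF line])
      moreover have "K2 x *\<^sub>R (s *\<^sub>R V1 q + t *\<^sub>R V2 q) = 0" using that by simp
      moreover have "(s * (K1 x - K2 x)) *\<^sub>R V1 q =
          ((s * K1 x) *\<^sub>R V1 q + (t * K2 x) *\<^sub>R V2 q) - K2 x *\<^sub>R (s *\<^sub>R V1 q + t *\<^sub>R V2 q)"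
        by (simp add: algebra_simps)
      ultimately have "(s * (K1 x - K2 x)) *\<^sub>R V1 q = 0" by simp
      moreover have "V1 q \<noteq> 0" using pd(1)[OF q'(2)] unfolding principal_direction_def by blast
      ultimately show "s = 0" using K_neq[OF x] by simp
    qed
    define i where "i = inverse (K2 x - K1 x)"
    have "fd X2 x (v1 x) = i *\<^sub>R ((K2 x - K1 x) *\<^sub>R fd X2 x (v1 x))" using K_neq[OF x] by (simp add: i_def)
    also have "\<dots> = (fd K1 x (v2 x) * i) *\<^sub>R X1 x + (- fd K2 x (v1 x) * i) *\<^sub>R X2 x"
      unfolding cod[OF x] by (simp add: algebra_simps)
    finally have "deriv_along A f V2 q (V1 q) = (fd K1 x (v2 x) * i) *\<^sub>R V1 q + (- fd K2 x (v1 x) * i) *\<^sub>R V2 q"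
      using D12[OF q(1)] q(2) X_eq[OF q'(1)] by simp
    from first_coefficient_eq[OF indep this]
    have "?\<Phi> q = fd K1 x (v2 x) * i" by simp
    then show ?thesis unfolding q(2) coord_rep_chart[OF c(1) q'(1)] by (simp add: i_def q(2))
  qed
  have dv2: "v2 differentiable (at u)"
    using tangent_coords_ck[OF T(1,3) smooth_onD[OF X(2)], of "Suc 0"] T(2) unfolding v2_def F_def by simp
  define D where "D w = fd (\<lambda>x. fd K1 x (v2 u)) u w" for w
  have "((\<lambda>x. fd K1 x (v2 x)) has_derivative D) (at u)"
    unfolding D_def by (rule fd_along_field_at_critical_point[OF T(1,2) K_ck(1) dv2 K1_crit])
  moreover define I where "I = fd (\<lambda>x. inverse (K2 x - K1 x)) u"
  have "((\<lambda>x. inverse (K2 x - K1 x)) has_derivative I) (at u)"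
  proof -
    have "ck_on (Suc 0) T (\<lambda>x. inverse (K2 x - K1 x))"
      by (intro ck_on_inverse ck_on_diff T(1) K_ck) (metis K_neq right_minus_eq)
    then show ?thesis unfolding I_def using T(2) by (auto intro: fd_works)
  qed
  ultimately have "((\<lambda>x. fd K1 x (v2 x) * inverse (K2 x - K1 x)) has_derivative
      (\<lambda>w. fd K1 u (v2 u) * I w + D w * inverse (K2 u - K1 u))) (at u)"
    by (rule has_derivative_mult)
  then have D\<Phi>: "(coord_rep c ?\<Phi> has_derivative (\<lambda>w. D w * inverse (K2 u - K1 u))) (at u)"
    using has_derivative_transform_within_open[OF _ T(1,2) \<Phi>] K1_crit by simp
  have "deriv_along A f ?\<Phi> p (V2 p) = D (v2 u) * inverse (K2 u - K1 u)"
    using deriv_along_chart[OF c differentiableI[OF D\<Phi>[unfolded u_def]], of "v2 u"] in_plane(2)[of p] c pW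
      fd_apply_eqI[OF D\<Phi>, of "v2 u"]
    unfolding coord_differential_def u_def by simp
  moreover have "D (v2 u) \<le> 0" unfolding D_def
    by (rule max_imp_second_derivative_le_0[OF T(1,2) dK(1) _ K1_max])
      (use K_ck(1)[of 2] T(2) in \<open>auto simp: numeral_2_eq_2\<close>)
  moreover have "inverse (K2 u - K1 u) < 0"
    using curv2_le_curv1[OF p] K_neq[OF T(2)] K_eq[OF c(2)] by (simp add: u_def)
  ultimately show False using neg by (smt (verit) mult_nonpos_nonpos)
qed

end

section \<open>Rigidity of Minkowski spheres\<close>

theorem theorem6p1:
  fixes nrm :: "real^3 \<Rightarrow> real"
    and M :: "'m::t2_space set" and A :: "'m chart set"
    and f \<eta> :: "'m \<Rightarrow> real^3"
  assumes "admissible_norm nrm"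
    and "smooth_surface M A" and "compact M" and "connected M" and "M \<noteq> {}"
    and "immersion M A f"
    and "birkhoff_normal_field nrm M A f \<eta>"
    and "\<And>p. p \<in> M \<Longrightarrow> (\<forall>q\<in>M. curv1 A f \<eta> q \<le> curv1 A f \<eta> p) \<Longrightarrow> coercively_convex_at M A f \<eta> p"
    and "minkowski_gauss_curvature A f \<eta> constant_on M"
  shows "minkowski_sphere nrm (f ` M)"
proof -
  interpret birkhoff_surface M A f nrm \<eta>
    by unfold_locales (use assms in auto)
  obtain k where k: "\<And>q. q \<in> M \<Longrightarrow> curv1 A f \<eta> q * curv2 A f \<eta> q = k"
    using assms(9) unfolding constant_on_def minkowski_gauss_curvature_def by blast
  have kpos: "k > 0" using gauss_curvature_positive_somewhere[OF assms(3,5)] k by metis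
  obtain p where p: "p \<in> M" "\<And>q. q \<in> M \<Longrightarrow> curv1 A f \<eta> q \<le> curv1 A f \<eta> p"
    using continuous_attains_sup[OF assms(3,5) curv1_continuous] by blast
  have umb: "umbilic A f \<eta> p"
    by (rule coercive_maximum_imp_umbilic[OF kpos k p]) (use assms(8) p in auto)
  define l where "l = curv1 A f \<eta> p"
  have all: "curv1 A f \<eta> q = l" "curv2 A f \<eta> q = l" if "q \<in> M" for q
    using umbilic_maximum_imp_totally_umbilic[OF assms(4) kpos k p(1) umb p(2) that] by (simp_all add: l_def)
  have "l \<noteq> 0" using k[OF p(1)] kpos by (auto simp: l_def)
  then show ?thesis
  proof (rule totally_umbilic_imp_minkowski_sphere[OF assms(3,4,5)])
    fix c q v assume c: "c \<in> A" "q \<in> fst c"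
    interpret birkhoff_patch "unit_sphere nrm" "snd c ` fst c" "coord_rep c f" "coord_rep c \<eta>"
      by (rule birkhoff_patch_chart[OF c(1)])
    have u: "snd c q \<in> snd c ` fst c" using c by blast
    have q: "q \<in> M" using c chart_subset by blast
    have "shape_disc (coord_rep c f) (coord_rep c \<eta>) (snd c q) = 0"
      using kappa_roots(4)[OF u] all[OF q] curv_chart[OF c] by simp
    from shape_disc_nonneg(2)[OF u this] show "coord_differential c \<eta> q v = l *\<^sub>R coord_differential c f q v"
      using all[OF q] curv_chart[OF c] unfolding coord_differential_def by simp
  qed
qed

end
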